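(* Suppose that $\widetilde M:=\int_0^\infty\big(\sup_{i\in\mathcal S,u\in U}|f(s,i,u)|+\delta(s)\big)ds<\infty$ and that $f(\cdot,i,u)$ (for all $i\in\mathcal S$, $u\in U$) and $\delta(\cdot)$ are continuous on $[0,\infty)$. Given $\lambda>0$, it holds for all $y\in\mathbb R^d$ that $$y=\widetilde J^\pi_\lambda\text{ for some regular relaxed equilibrium }\pi\in\Pi_r\text{ for }\widetilde J_\lambda\iff\widetilde\Psi_\lambda(y)=y.$$ In particular, $\widetilde\Psi_\lambda(y)=y$ implies that $\widetilde\Gamma_\lambda(y,\cdot)\in\Pi_r$ is a regular relaxed equilibrium for $\widetilde J_\lambda$.
   Context: Setting (continuous time). Fix $\ell,d\in\mathbb N$; $U\subset\mathbb R^\ell$ is compact with Lebesgue measure $\mathrm{Leb}(U)>0$; $\mathcal S=\{1,\dots,d\}$. For each $u\in U$, $q^u=(q^u_{ij})$ is a $d\times d$ rate matrix ($q^u_{ij}\ge0$ for $j\ne i$, $q^u_{ii}=-\sum_{j\ne i}q^u_{ij}$), with $i$-th row $q^u_i\in\mathbb R^d$. $\mathcal P(U)$ is the set of probability measures on $U$, $\mathcal D(U)$ the set of probability density functions on $U$ (w.r.t. Lebesgue measure, identified when a.e. equal). For $\mu\in\mathcal P(U)$, $Q^\mu_{ij}:=\int_Uq^u_{ij}\mu(du)$, with $i$-th row $Q^\mu_i$. A relaxed feedback control is a map $\pi:\mathcal S\to\mathcal P(U)$; $\Pi$ is the set of all of them. Under $\pi$, $X^\pi$ is the continuous-time $\mathcal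 S$-valued Markov chain whose generator has $i$-th row $Q^{\pi(i)}_i$. $\mathbb E_i$ is expectation given $X_0=i$. The reward is $f:[0,\infty)\times\mathcal S\times U\to\mathbb R$, and $f^\mu(t,i):=\int_Uf(t,i,u)\mu(du)$. The discount function $\delta:[0,\infty)\to[0,1]$ is nonincreasing with $\delta(0)=1$. For $\rho\in\mathcal D(U)$, $\mathcal H(\rho):=-\int_U\ln(\rho(u))\rho(u)\,du$. $\Pi_r$ is the set of regular relaxed feedback controls: those $\pi\in\Pi$ such that each $\pi(i)$ has a density in $\mathcal D(U)$ (identified with $\pi(i)$) with $\mathcal H(\pi(i))>-\infty$. For $\lambda>0$, $\pi\in\Pi_r$: $$\widetilde J^\pi_\lambda(i):=\mathbb E_i\Big[\int_0^\infty\big(f^{\pi(X^\pi_s)}(s,X^\pi_s)+\lambda\delta(s)\mathcal H(\pi(X^\pi_s))\big)ds\Big],\qquad \widetilde J^\pi_\lambda=(\widetilde J^\pi_\lambda(1),\dots,\widetilde J^\pi_\lambda(d))\in\mathbb R^d.$$ For $\varepsilon>0$, $\pi'\otimes_\varepsilon\pi$ means using $\pi'$ on $[0,\varepsilon)$ and $\pi$ on $[\varepsilon,\infty)$ (both for the dynamics and in the reward/entropy terms). $\pi\in\Pi_r$ is a regular relaxed equilibrium (for $\widetilde J_\lambda$) if $\limsup_{\varepsilon\downarrow0}\frac{\widetilde J_\lambda^{\pi'\otimes_\varepsilon\pi}(i)-\widetilde J_\lambda^\pi(i)}{\varepsilon}\le0$ for all $\pi'\in\Pi_r$ and $i\in\mathcal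 S$. $\widetilde\Gamma_\lambda:\mathbb R^d\times\mathcal S\to\mathcal D(U)$ is $$\widetilde\Gamma_\lambda(y,i)(u):=\frac{e^{\frac1\lambda(f(0,i,u)+q^u_i\cdot y)}}{\int_Ue^{\frac1\lambda(f(0,i,v)+q^v_i\cdot y)}dv},$$ and $\widetilde\Psi_\lambda:\mathbb R^d\to\mathbb R^d$ is $\widetilde\Psi_\lambda(y):=\widetilde J_\lambda^{\widetilde\Gamma_\lambda(y,\cdot)}$.
   Formalization: Adds the hypothesis that f is bounded on [0,ε]×S×U for some ε>0; without it the claim fails (e.g. d=1, q=0, U=[0,2], λ=1, δ(s)=e^{-s}, f(s,u)=c(s)s^{-1/2}φ(u/√s), f(0,u)=0, with φ a continuous bump on [1,2] and c a cutoff). *)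

theory Defs
  imports "HOL-Probability.Probability"
begin

text \<open>
  The state space is a finite type \<open>'s\<close> and vectors indexed by states live in \<open>real ^ 's\<close>.
  The action set \<open>U\<close> is a subset of \<open>real ^ 'l\<close>.
\<close>

abbreviation leb_on :: "(real ^ 'l) set \<Rightarrow> (real ^ 'l) measure" where
  "leb_on U \<equiv> restrict_space lborel U"

definition prob_measures :: "(real ^ 'l) set \<Rightarrow> (real ^ 'l) measure set" where
  "prob_measures U = {\<mu>. prob_space \<mu> \<and> sets \<mu> = sets (restrict_space borel U)}"

definition prob_densities :: "(real ^ 'l) set \<Rightarrow> (real ^ 'l \<Rightarrow> real) set" where
  "prob_densities U = {\<rho>. \<rho> \<in> borel_measurable (leb_on U) \<and> (\<forall>u\<in>U. 0 \<le> \<rho> u) \<and>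
     (\<integral>\<^sup>+ u. ennreal (\<rho> u) \<partial>leb_on U) = 1}"

definition measure_of_density ::
  "(real ^ 'l) set \<Rightarrow> (real ^ 'l \<Rightarrow> real) \<Rightarrow> (real ^ 'l) measure" where
  "measure_of_density U \<rho> = density (leb_on U) (\<lambda>u. ennreal (\<rho> u))"

definition density_of ::
  "(real ^ 'l) set \<Rightarrow> (real ^ 'l) measure \<Rightarrow> real ^ 'l \<Rightarrow> real" where
  "density_of U \<mu> = (\<lambda>u. enn2real (RN_deriv (leb_on U) \<mu> u))"

text \<open>
  The entropy takes values in the extended reals. For bounded \<open>U\<close> the first integral is finite,
  because \<open>- r * ln r \<le> exp (- 1)\<close> for \<open>r \<ge> 0\<close>, so no difference of infinities occurs.
  The convention \<open>ln 0 * 0 = 0\<close> is the usual one.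
\<close>

definition entropy_density :: "(real ^ 'l) set \<Rightarrow> (real ^ 'l \<Rightarrow> real) \<Rightarrow> ereal" where
  "entropy_density U \<rho> =
     enn2ereal (\<integral>\<^sup>+ u. ennreal (- (ln (\<rho> u) * \<rho> u)) \<partial>leb_on U)
     - enn2ereal (\<integral>\<^sup>+ u. ennreal (ln (\<rho> u) * \<rho> u) \<partial>leb_on U)"

definition entropy_measure :: "(real ^ 'l) set \<Rightarrow> (real ^ 'l) measure \<Rightarrow> ereal" where
  "entropy_measure U \<mu> = entropy_density U (density_of U \<mu>)"

type_synonym ('s, 'l) control = "'s \<Rightarrow> (real ^ 'l) measure"

definition relaxed_controls :: "(real ^ 'l) set \<Rightarrow> ('s, 'l) control set" where
  "relaxed_controls U = {\<pi>. \<forall>i. \<pi> i \<in> prob_measures U}"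

definition regular_controls :: "(real ^ 'l) set \<Rightarrow> ('s, 'l) control set" where
  "regular_controls U = {\<pi> \<in> relaxed_controls U.
     \<forall>i. (\<exists>\<rho>\<in>prob_densities U. \<pi> i = measure_of_density U \<rho>) \<and> - \<infinity> < entropy_measure U (\<pi> i)}"

text \<open>
  A time-dependent control assigns to each time the feedback control in force. A feedback control
  \<open>\<pi>\<close> is used as \<open>\<lambda>_. \<pi>\<close>.
\<close>

definition concat_control ::
  "('s, 'l) control \<Rightarrow> real \<Rightarrow> ('s, 'l) control \<Rightarrow> real \<Rightarrow> ('s, 'l) control" where
  "concat_control \<pi>' \<epsilon> \<pi> = (\<lambda>t. if t < \<epsilon> then \<pi>' else \<pi>)"

definition rate_matrix :: "real ^ 's ^ 's::finite \<Rightarrow> bool" where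
  "rate_matrix A \<longleftrightarrow> (\<forall>i j. j \<noteq> i \<longrightarrow> 0 \<le> A $ i $ j) \<and>
     (\<forall>i. A $ i $ i = - (\<Sum>j\<in>UNIV - {i}. A $ i $ j))"

definition mean_rates ::
  "(real ^ 'l \<Rightarrow> real ^ 's ^ 's::finite) \<Rightarrow> (real ^ 'l) measure \<Rightarrow> real ^ 's ^ 's" where
  "mean_rates q \<mu> = (\<chi> i j. \<integral>u. q u $ i $ j \<partial>\<mu>)"

definition control_generator ::
  "(real ^ 'l \<Rightarrow> real ^ 's ^ 's::finite) \<Rightarrow> ('s, 'l) control \<Rightarrow> real ^ 's ^ 's" where
  "control_generator q \<pi> = (\<chi> i. mean_rates q (\<pi> i) $ i)"

text \<open>
  Here \<open>P s t $ i $ j\<close> is the probability of being in \<open>j\<close> at time \<open>t\<close> given state \<open>i\<close> at time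
  \<open>s \<le> t\<close>. The generator \<open>A s\<close> may depend on time, since a concatenated control switches once;
  continuity of \<open>P s\<close> on \<open>{s..}\<close> excludes jumps at deterministic times, which right derivatives
  alone would not detect. For constant \<open>A\<close> this forces \<open>P s t\<close> to be the matrix exponential of
  \<open>(t - s) *\<^sub>R A\<close>.
\<close>

definition transition_function ::
  "(real \<Rightarrow> real \<Rightarrow> real ^ 's ^ 's::finite) \<Rightarrow> bool" where
  "transition_function P \<longleftrightarrow>
     (\<forall>s t. 0 \<le> s \<longrightarrow> s \<le> t \<longrightarrow>
        (\<forall>i j. 0 \<le> P s t $ i $ j) \<and> (\<forall>i. (\<Sum>j\<in>UNIV. P s t $ i $ j) = 1)) \<and>
     (\<forall>s. 0 \<le> s \<longrightarrow> P s s = mat 1) \<and>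
     (\<forall>s t r. 0 \<le> s \<longrightarrow> s \<le> t \<longrightarrow> t \<le> r \<longrightarrow> P s r = P s t ** P t r)"

definition has_generator ::
  "(real \<Rightarrow> real \<Rightarrow> real ^ 's ^ 's::finite) \<Rightarrow> (real \<Rightarrow> real ^ 's ^ 's) \<Rightarrow> bool" where
  "has_generator P A \<longleftrightarrow>
     (\<forall>s. 0 \<le> s \<longrightarrow> continuous_on {s..} (P s) \<and>
        ((\<lambda>h. (1 / h) *\<^sub>R (P s (s + h) - mat 1)) \<longlongrightarrow> A s) (at_right 0))"

text \<open>
  A Markov chain with right-continuous paths (for the discrete topology on the states), started
  in \<open>i\<close>, with generator \<open>A s\<close> at time \<open>s\<close>. The last conjunct is the Markov property, with the
  conditional probabilities multiplied out.
\<close>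

definition markov_chain ::
  "'w measure \<Rightarrow> (real \<Rightarrow> 'w \<Rightarrow> 's::finite) \<Rightarrow> (real \<Rightarrow> real ^ 's ^ 's) \<Rightarrow> 's \<Rightarrow> bool" where
  "markov_chain M X A i \<longleftrightarrow>
     prob_space M \<and>
     (\<forall>t\<ge>0. X t \<in> measurable M (count_space UNIV)) \<and>
     (\<forall>\<omega>\<in>space M. \<forall>t\<ge>0. \<forall>\<^sub>F s in at_right t. X s \<omega> = X t \<omega>) \<and>
     (AE \<omega> in M. X 0 \<omega> = i) \<and>
     (\<exists>P. transition_function P \<and> has_generator P A \<and>
        (\<forall>(n::nat) (t::nat \<Rightarrow> real) (x::nat \<Rightarrow> 's).
           0 \<le> t 0 \<longrightarrow> (\<forall>k\<le>n. t k \<le> t (Suc k)) \<longrightarrow>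
           measure M {\<omega>\<in>space M. \<forall>k\<le>Suc n. X (t k) \<omega> = x k} =
           measure M {\<omega>\<in>space M. \<forall>k\<le>n. X (t k) \<omega> = x k} * P (t n) (t (Suc n)) $ x n $ x (Suc n)))"

text \<open>
  A realization of all controlled chains: for a time-dependent control \<open>\<alpha>\<close> and an initial state
  \<open>i\<close>, the chain \<open>X \<alpha> i\<close> lives on the probability space \<open>M \<alpha> i\<close>. Only the controls entering the
  definition of an equilibrium, namely \<open>\<pi>\<close> itself and the concatenations, are constrained.
\<close>

definition controlled_chains ::
  "(real ^ 'l) set \<Rightarrow> (real ^ 'l \<Rightarrow> real ^ 's ^ 's::finite) \<Rightarrow>
   ((real \<Rightarrow> ('s, 'l) control) \<Rightarrow> 's \<Rightarrow> 'w measure) \<Rightarrow>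
   ((real \<Rightarrow> ('s, 'l) control) \<Rightarrow> 's \<Rightarrow> real \<Rightarrow> 'w \<Rightarrow> 's) \<Rightarrow> bool" where
  "controlled_chains U q M X \<longleftrightarrow>
     (\<forall>\<pi>\<in>regular_controls U. \<forall>i.
        markov_chain (M (\<lambda>_. \<pi>) i) (X (\<lambda>_. \<pi>) i) (\<lambda>_. control_generator q \<pi>) i) \<and>
     (\<forall>\<pi>'\<in>regular_controls U. \<forall>\<pi>\<in>regular_controls U. \<forall>\<epsilon>>0. \<forall>i.
        markov_chain (M (concat_control \<pi>' \<epsilon> \<pi>) i) (X (concat_control \<pi>' \<epsilon> \<pi>) i)
          (\<lambda>s. control_generator q (concat_control \<pi>' \<epsilon> \<pi> s)) i)"

definition mean_reward ::
  "(real \<Rightarrow> 's \<Rightarrow> real ^ 'l \<Rightarrow> real) \<Rightarrow> (real ^ 'l) measure \<Rightarrow> real \<Rightarrow> 's \<Rightarrow> real" where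
  "mean_reward f \<mu> t i = (\<integral>u. f t i u \<partial>\<mu>)"

definition value_at ::
  "(real ^ 'l) set \<Rightarrow> (real \<Rightarrow> 's \<Rightarrow> real ^ 'l \<Rightarrow> real) \<Rightarrow> (real \<Rightarrow> real) \<Rightarrow> real \<Rightarrow>
   ((real \<Rightarrow> ('s, 'l) control) \<Rightarrow> 's \<Rightarrow> 'w measure) \<Rightarrow>
   ((real \<Rightarrow> ('s, 'l) control) \<Rightarrow> 's \<Rightarrow> real \<Rightarrow> 'w \<Rightarrow> 's) \<Rightarrow>
   (real \<Rightarrow> ('s, 'l) control) \<Rightarrow> 's \<Rightarrow> real" where
  "value_at U f \<delta> lam M X \<alpha> i =
     (\<integral>\<omega>. (LINT s:{0..}|lborel.
         mean_reward f (\<alpha> s (X \<alpha> i s \<omega>)) s (X \<alpha> i s \<omega>)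
         + lam * \<delta> s * real_of_ereal (entropy_measure U (\<alpha> s (X \<alpha> i s \<omega>)))) \<partial>M \<alpha> i)"

definition value_vec ::
  "(real ^ 'l) set \<Rightarrow> (real \<Rightarrow> 's \<Rightarrow> real ^ 'l \<Rightarrow> real) \<Rightarrow> (real \<Rightarrow> real) \<Rightarrow> real \<Rightarrow>
   ((real \<Rightarrow> ('s, 'l) control) \<Rightarrow> 's \<Rightarrow> 'w measure) \<Rightarrow>
   ((real \<Rightarrow> ('s, 'l) control) \<Rightarrow> 's \<Rightarrow> real \<Rightarrow> 'w \<Rightarrow> 's) \<Rightarrow>
   ('s::finite, 'l) control \<Rightarrow> real ^ 's" where
  "value_vec U f \<delta> lam M X \<pi> = (\<chi> i. value_at U f \<delta> lam M X (\<lambda>_. \<pi>) i)"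

definition regular_equilibrium ::
  "(real ^ 'l) set \<Rightarrow> (real \<Rightarrow> 's \<Rightarrow> real ^ 'l \<Rightarrow> real) \<Rightarrow> (real \<Rightarrow> real) \<Rightarrow> real \<Rightarrow>
   ((real \<Rightarrow> ('s, 'l) control) \<Rightarrow> 's \<Rightarrow> 'w measure) \<Rightarrow>
   ((real \<Rightarrow> ('s, 'l) control) \<Rightarrow> 's \<Rightarrow> real \<Rightarrow> 'w \<Rightarrow> 's) \<Rightarrow>
   ('s, 'l) control \<Rightarrow> bool" where
  "regular_equilibrium U f \<delta> lam M X \<pi> \<longleftrightarrow>
     \<pi> \<in> regular_controls U \<and>
     (\<forall>\<pi>'\<in>regular_controls U. \<forall>i.
        Limsup (at_right 0) (\<lambda>\<epsilon>. ereal
          ((value_at U f \<delta> lam M X (concat_control \<pi>' \<epsilon> \<pi>) i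
            - value_at U f \<delta> lam M X (\<lambda>_. \<pi>) i) / \<epsilon>)) \<le> 0)"

definition Gamma_map ::
  "(real ^ 'l) set \<Rightarrow> (real ^ 'l \<Rightarrow> real ^ 's ^ 's::finite) \<Rightarrow>
   (real \<Rightarrow> 's \<Rightarrow> real ^ 'l \<Rightarrow> real) \<Rightarrow> real \<Rightarrow> real ^ 's \<Rightarrow> 's \<Rightarrow> real ^ 'l \<Rightarrow> real" where
  "Gamma_map U q f lam y i u =
     exp (1 / lam * (f 0 i u + (q u $ i) \<bullet> y))
     / (\<integral>v. exp (1 / lam * (f 0 i v + (q v $ i) \<bullet> y)) \<partial>leb_on U)"

definition Gamma_control ::
  "(real ^ 'l) set \<Rightarrow> (real ^ 'l \<Rightarrow> real ^ 's ^ 's::finite) \<Rightarrow>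
   (real \<Rightarrow> 's \<Rightarrow> real ^ 'l \<Rightarrow> real) \<Rightarrow> real \<Rightarrow> real ^ 's \<Rightarrow> ('s, 'l) control" where
  "Gamma_control U q f lam y = (\<lambda>i. measure_of_density U (Gamma_map U q f lam y i))"

definition Psi_map ::
  "(real ^ 'l) set \<Rightarrow> (real ^ 'l \<Rightarrow> real ^ 's ^ 's::finite) \<Rightarrow>
   (real \<Rightarrow> 's \<Rightarrow> real ^ 'l \<Rightarrow> real) \<Rightarrow> (real \<Rightarrow> real) \<Rightarrow> real \<Rightarrow>
   ((real \<Rightarrow> ('s, 'l) control) \<Rightarrow> 's \<Rightarrow> 'w measure) \<Rightarrow>
   ((real \<Rightarrow> ('s, 'l) control) \<Rightarrow> 's \<Rightarrow> real \<Rightarrow> 'w \<Rightarrow> 's) \<Rightarrow> real ^ 's \<Rightarrow> real ^ 's" where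
  "Psi_map U q f \<delta> lam M X y = value_vec U f \<delta> lam M X (Gamma_control U q f lam y)"

end

theory Submission
  imports Defs
begin

text \<open>
  Using \<open>\<pi>'\<close> on \<open>[0, \<epsilon>)\<close> and \<open>\<pi>\<close> afterwards changes the value from \<open>i\<close> at first order in \<open>\<epsilon>\<close> by
  \<open>g(\<pi>') - g(\<pi>)\<close>, where \<open>g(\<pi>)\<close> is the integral of \<open>f(0,i,u) + q\<^sup>u\<^sub>i \<bullet> y\<close> against \<open>\<pi> i\<close> plus \<open>\<lambda>\<close> times the
  entropy of \<open>\<pi> i\<close>, and \<open>y\<close> is the value vector of \<open>\<pi>\<close>. Indeed both chains run with the
  semigroup of \<open>\<pi>\<close> after \<open>\<epsilon>\<close>, so the two values differ by an average of rewards over \<open>[0, \<epsilon>)\<close> and by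
  the difference of the laws at time \<open>\<epsilon>\<close> applied to continuation values, which tend to \<open>y\<close>. Hence
  \<open>\<pi>\<close> is an equilibrium iff each \<open>\<pi> i\<close> maximizes \<open>g\<close>, and by the Gibbs inequality the unique
  maximizer is the Gibbs density, that is, \<open>\<pi> = \<Gamma>(y)\<close>.
\<close>

section \<open>Transition functions with a given generator\<close>

text \<open>\<open>markov_chain\<close> provides its transition function by an existential
  quantifier, separately for every control and every initial state. Values become comparable only
  after a uniqueness theorem identifies these functions. That theorem can use just continuity and
  right derivatives of \<open>P s\<close>, for a generator that may jump at \<epsilon>; hence the
  barrier argument for one-sided derivatives that opens the proof.

  A second obstacle is time. Fubini requires joint measurability in time and sample point, or in
  time and action, which has to be recovered from right continuity; and integrability over time says
  nothing about the single time 0, where the first-order expansion takes place, so that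
  \<open>f_bdd_near_0\<close> has to control it.

  The third is the action variable. The regularity of \<open>q\<close> in the action is given as
  integrability against every probability measure on \<open>U\<close>, while the Gibbs density
  requires an exponential of the rates to be integrable. Testing with discrete measures shows that
  such rates are bounded.\<close>

lemma zero_of_right_derivative_bound:
  fixes \<phi> :: "real \<Rightarrow> 'a::real_normed_vector"
  assumes cont: "continuous_on {a..b} \<phi>" and init: "\<phi> a = 0"
    and deriv: "\<And>t. a \<le> t \<Longrightarrow> t < b \<Longrightarrow>
      ((\<lambda>h. (1 / h) *\<^sub>R (\<phi> (t + h) - \<phi> t)) \<longlongrightarrow> \<phi>' t) (at_right 0)"
    and bound: "\<And>t. a \<le> t \<Longrightarrow> t < b \<Longrightarrow> norm (\<phi>' t) \<le> C * norm (\<phi> t)"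
    and t: "t \<in> {a..b}"
  shows "\<phi> t = 0"
proof -
  \<comment> \<open>The function \<open>e * exp (K * (s - a))\<close> serves as a barrier of
    arbitrarily small height \<open>e\<close>. The extra 1 makes the right derivative of \<phi>
    strictly smaller in norm than the slope of the barrier wherever the two touch.\<close>
  define K where "K = C + 1"
  have le: "norm (\<phi> t) \<le> e * exp (K * (t - a))" if e: "0 < e" for e
  proof (rule ccontr)
    assume nle: "\<not> ?thesis"
    define \<psi> where "\<psi> s = norm (\<phi> s) - e * exp (K * (s - a))" for s
    \<comment> \<open>We contradict the choice of the last time \<open>r\<close> before \<open>t\<close> at which the bound holds: there the
      bound is attained, and the right derivative at \<open>r\<close> is too small to violate it right after \<open>r\<close>.\<close>
    define S where "S = {s \<in> {a..t}. \<psi> s \<le> 0}"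
    have psi_cont: "continuous_on {a..t} \<psi>"
      unfolding \<psi>_def using t by (auto intro!: continuous_intros continuous_on_subset[OF cont])
    have "closed S"
      unfolding S_def using continuous_closed_preimage[OF psi_cont closed_real_atLeastAtMost, of "{..0}"]
      by (simp add: vimage_def Int_def)
    moreover have "bounded S" unfolding S_def by (rule bounded_subset[of "{a..t}"]) auto
    ultimately have "compact S" by (simp add: compact_eq_bounded_closed)
    moreover have "a \<in> S" using t e init by (auto simp: S_def \<psi>_def)
    ultimately obtain r where r: "r \<in> S" "\<And>s. s \<in> S \<Longrightarrow> s \<le> r"
      using compact_attains_sup[of S] by blast
    have pos: "0 < \<psi> s" if "r < s" "s \<le> t" for s
      using r(1) r(2)[of s] that by (force simp: S_def not_le)
    have rt: "a \<le> r" "r < t" "\<psi> r \<le> 0"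
      using r(1) nle by (auto simp: S_def \<psi>_def) (metis diff_le_0_iff_le less_eq_real_def)
    have "continuous_on {r..t} \<psi>"
      using rt by (intro continuous_on_subset[OF psi_cont]) auto
    then have "(\<psi> \<longlongrightarrow> \<psi> r) (at_right r)"
      using rt(2) by (force simp: continuous_on_def simp flip: at_within_Icc_at_right)
    moreover have "\<forall>\<^sub>F s in at_right r. 0 \<le> \<psi> s"
      using eventually_at_right_less[of r] eventually_at_right_real[OF rt(2)]
      by eventually_elim (use pos in force)
    ultimately have "0 \<le> \<psi> r"
      by (intro tendsto_lowerbound) auto
    with rt have w: "norm (\<phi> r) = e * exp (K * (r - a))" by (simp add: \<psi>_def)
    then have w_pos: "0 < norm (\<phi> r)" using e by simp
    have "((\<lambda>h. norm ((1 / h) *\<^sub>R (\<phi> (r + h) - \<phi> r))) \<longlongrightarrow> norm (\<phi>' r)) (at_right 0)"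
      using deriv[of r] rt t by (intro tendsto_norm) auto
    moreover have "norm (\<phi>' r) < K * norm (\<phi> r)"
      using bound[of r] rt t w_pos by (auto simp: K_def algebra_simps intro: le_less_trans)
    ultimately have "\<forall>\<^sub>F h in at_right 0. norm ((1 / h) *\<^sub>R (\<phi> (r + h) - \<phi> r)) < K * norm (\<phi> r)"
      by (rule order_tendstoD)
    moreover have "\<forall>\<^sub>F h in at_right 0. h \<in> {0<..<t - r}"
      using rt by (intro eventually_at_right_real) auto
    ultimately have "\<forall>\<^sub>F h in at_right (0::real). False"
    proof eventually_elim
      case (elim h)
      then have h: "0 < h" "h < t - r" by auto
      have "norm (\<phi> (r + h)) - norm (\<phi> r) \<le> norm (\<phi> (r + h) - \<phi> r)"
        by (rule norm_triangle_ineq2)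
      also have "\<dots> < h * (K * norm (\<phi> r))"
        using elim(1) h by (simp del: scaleR_diff_right add: pos_divide_less_eq mult.commute)
      finally have "norm (\<phi> (r + h)) < norm (\<phi> r) * (1 + K * h)" by (simp add: algebra_simps)
      also have "\<dots> \<le> norm (\<phi> r) * exp (K * h)"
        using exp_ge_add_one_self[of "K * h"] by (intro mult_left_mono) auto
      also have "\<dots> = e * exp (K * (r + h - a))"
        by (simp add: w exp_add[symmetric] algebra_simps)
      finally have "\<psi> (r + h) < 0" by (simp add: \<psi>_def)
      with pos[of "r + h"] h show False by simp
    qed
    then show False by (simp add: trivial_limit_at_right_real)
  qed
  have "norm (\<phi> t) \<le> 0"
  proof (rule field_le_epsilon)
    fix e :: real assume "0 < e"
    then show "norm (\<phi> t) \<le> 0 + e"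
      using le[of "e / exp (K * (t - a))"] by simp
  qed
  then show ?thesis by simp
qed

lemma bounded_linear_matrix_mult_left:
  fixes A :: "real ^ 'n::finite ^ 'm::finite"
  shows "bounded_linear (\<lambda>B :: real ^ 'k::finite ^ 'n. A ** B)"
  by (rule linear_conv_bounded_linear[THEN iffD1], rule linearI)
    (simp_all add: matrix_matrix_mult_def vec_eq_iff algebra_simps sum.distrib sum_distrib_left)

lemma bounded_linear_matrix_mult_right:
  fixes B :: "real ^ 'k::finite ^ 'n::finite"
  shows "bounded_linear (\<lambda>A :: real ^ 'n ^ 'm::finite. A ** B)"
  by (rule linear_conv_bounded_linear[THEN iffD1], rule linearI)
    (simp_all add: matrix_matrix_mult_def vec_eq_iff algebra_simps sum.distrib sum_distrib_left)

lemma transition_refl: "transition_function P \<Longrightarrow> 0 \<le> s \<Longrightarrow> P s s = mat 1"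
  unfolding transition_function_def by blast

lemma transition_comp:
  "transition_function P \<Longrightarrow> 0 \<le> s \<Longrightarrow> s \<le> t \<Longrightarrow> t \<le> r \<Longrightarrow> P s r = P s t ** P t r"
  unfolding transition_function_def by blast

text \<open>Kolmogorov's forward equation in its one-sided form. Chapman-Kolmogorov pulls the factor
  \<open>P s t\<close> out on the left, which leaves the difference quotient at time
  \<open>t\<close> that defines the generator.\<close>

lemma transition_right_derivative:
  assumes P: "transition_function P" "has_generator P A" and "0 \<le> s" "s \<le> t"
  shows "((\<lambda>h. (1 / h) *\<^sub>R (P s (t + h) - P s t)) \<longlongrightarrow> P s t ** A t) (at_right 0)"
proof -
  interpret L: bounded_linear "\<lambda>B. P s t ** B" by (rule bounded_linear_matrix_mult_left)
  have "((\<lambda>h. P s t ** ((1 / h) *\<^sub>R (P t (t + h) - mat 1))) \<longlongrightarrow> P s t ** A t) (at_right 0)"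
    using P(2) assms(3,4) by (intro L.tendsto) (auto simp: has_generator_def)
  moreover have "\<forall>\<^sub>F h in at_right 0.
      P s t ** ((1 / h) *\<^sub>R (P t (t + h) - mat 1)) = (1 / h) *\<^sub>R (P s (t + h) - P s t)"
    using eventually_at_right_less[of 0]
  proof eventually_elim
    case (elim h)
    then have "P s (t + h) = P s t ** P t (t + h)"
      using assms(3,4) by (intro transition_comp[OF P(1)]) auto
    then show ?case by (simp add: L.scaleR L.diff)
  qed
  ultimately show ?thesis by (rule Lim_transform_eventually)
qed

text \<open>The difference of the two sides starts at 0 and solves the linear equation with
  right-hand side \<open>\<phi> t ** C\<close>. The starting times \<open>s\<close> and
  \<open>r\<close> may differ, and the generators are compared on a window of length
  \<open>T\<close> only: this allows a concatenated chain to be matched with one semigroup before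
  the switch and with another, restarted at time 0, after it. The generators must agree for times
  below \<open>T\<close>, whereas the conclusion includes \<open>T\<close>, by continuity.\<close>

lemma transition_function_unique:
  fixes P R :: "real \<Rightarrow> real \<Rightarrow> real ^ 's ^ 's::finite"
  assumes P: "transition_function P" "has_generator P A"
    and R: "transition_function R" "has_generator R B"
    and nonneg: "0 \<le> s" "0 \<le> r"
    and A: "\<And>t. 0 \<le> t \<Longrightarrow> t < T \<Longrightarrow> A (s + t) = C"
    and B: "\<And>t. 0 \<le> t \<Longrightarrow> t < T \<Longrightarrow> B (r + t) = C"
    and t: "0 \<le> t" "t \<le> T"
  shows "P s (s + t) = R r (r + t)"
proof -
  interpret C: bounded_linear "\<lambda>D :: real ^ 's ^ 's. D ** C" by (rule bounded_linear_matrix_mult_right)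
  obtain K where K: "\<And>D :: real ^ 's ^ 's. norm (D ** C) \<le> norm D * K" using C.bounded by blast
  define \<phi> where "\<phi> t = P s (s + t) - R r (r + t)" for t
  have "\<phi> t = 0"
  proof (rule zero_of_right_derivative_bound[where a = 0 and b = T and C = K])
    have "continuous_on {s..} (P s)" "continuous_on {r..} (R r)"
      using P R nonneg by (auto simp: has_generator_def)
    then show "continuous_on {0..T} \<phi>"
      unfolding \<phi>_def by (intro continuous_intros; elim continuous_on_compose2) 
        (auto intro!: continuous_intros)
    show "\<phi> 0 = 0"
      using P R nonneg by (simp add: \<phi>_def transition_refl)
    show "norm (\<phi> t ** C) \<le> K * norm (\<phi> t)" for t
      using K[of "\<phi> t"] by (simp add: mult.commute)
    show "((\<lambda>h. (1 / h) *\<^sub>R (\<phi> (t + h) - \<phi> t)) \<longlongrightarrow> \<phi> t ** C) (at_right 0)"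
      if "0 \<le> t" "t < T" for t
    proof -
      have "((\<lambda>h. (1 / h) *\<^sub>R (P s (s + t + h) - P s (s + t)) - (1 / h) *\<^sub>R (R r (r + t + h) - R r (r + t)))
          \<longlongrightarrow> P s (s + t) ** A (s + t) - R r (r + t) ** B (r + t)) (at_right 0)"
        using that nonneg
        by (intro tendsto_diff transition_right_derivative[OF P] transition_right_derivative[OF R]) auto
      moreover have "P s (s + t) ** A (s + t) - R r (r + t) ** B (r + t) = \<phi> t ** C"
        by (simp only: \<phi>_def A[OF that] B[OF that] C.diff)
      moreover have "(1 / h) *\<^sub>R (P s (s + t + h) - P s (s + t)) - (1 / h) *\<^sub>R (R r (r + t + h) - R r (r + t))
          = (1 / h) *\<^sub>R (\<phi> (t + h) - \<phi> t)" for h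
        unfolding \<phi>_def scaleR_diff_right[symmetric] by (simp add: add.assoc)
      ultimately show ?thesis by simp
    qed
  qed (use t in auto)
  then show ?thesis by (simp add: \<phi>_def)
qed

lemma transition_abs_le_1:
  assumes "transition_function P" "0 \<le> s" "s \<le> t"
  shows "\<bar>P s t $ i $ j\<bar> \<le> 1"
proof -
  have nn: "\<And>j. 0 \<le> P s t $ i $ j" and one: "(\<Sum>j\<in>UNIV. P s t $ i $ j) = 1"
    using assms(1)[unfolded transition_function_def, THEN conjunct1, rule_format, OF assms(2,3)]
    by auto
  have "P s t $ i $ j \<le> (\<Sum>j\<in>UNIV. P s t $ i $ j)"
    by (rule member_le_sum) (use nn in auto)
  then show ?thesis using nn one by simp
qed

lemma transition_entry_continuous:
  "has_generator P A \<Longrightarrow> 0 \<le> s \<Longrightarrow> continuous_on {s..} (\<lambda>t. P s t $ i $ j)"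
  unfolding has_generator_def by (intro continuous_on_component) blast

lemma transition_entry_derivative:
  assumes "has_generator P A"
  shows "((\<lambda>h. (P 0 h $ i $ j - mat 1 $ i $ j) / h) \<longlongrightarrow> A 0 $ i $ j) (at_right 0)"
proof -
  have "((\<lambda>h. (1 / h) *\<^sub>R (P 0 (0 + h) - mat 1)) \<longlongrightarrow> A 0) (at_right 0)"
    using assms unfolding has_generator_def by blast
  from tendsto_vec_nth[OF tendsto_vec_nth[OF this]]
  show ?thesis by simp
qed

section \<open>Limits of integrals over time\<close>

lemma right_limit_of_continuous_on:
  fixes g :: "real \<Rightarrow> real"
  assumes "continuous_on {0..} g" "0 \<le> t"
  shows "(g \<longlongrightarrow> g t) (at_right t)"
proof -
  have "continuous_on {t..t + 1} g"
    by (rule continuous_on_subset[OF assms(1)]) (use assms(2) in auto)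
  then have "(g \<longlongrightarrow> g t) (at t within {t..t + 1})"
    by (auto simp: continuous_on_def)
  then show ?thesis by (simp add: at_within_Icc_at_right)
qed

lemma set_integrable_mult_bounded:
  fixes p g :: "real \<Rightarrow> real"
  assumes p: "continuous_on {a..} p" "\<And>t. a \<le> t \<Longrightarrow> \<bar>p t\<bar> \<le> 1"
    and g: "set_integrable lborel {a..} g"
  shows "set_integrable lborel {a..} (\<lambda>t. p t * g t)"
proof (rule set_integrable_bound[OF g])
  have "(\<lambda>t. indicator {a..} t *\<^sub>R p t) \<in> borel_measurable borel"
    using p(1) by (intro borel_measurable_continuous_on_indicator) auto
  moreover have "(\<lambda>t. indicator {a..} t *\<^sub>R g t) \<in> borel_measurable borel"
    using g by (auto simp: set_integrable_def dest: borel_measurable_integrable)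
  ultimately have "(\<lambda>t. (indicator {a..} t *\<^sub>R p t) * (indicator {a..} t *\<^sub>R g t)) \<in> borel_measurable borel"
    by (rule borel_measurable_times)
  also have "(\<lambda>t. (indicator {a..} t *\<^sub>R p t) * (indicator {a..} t *\<^sub>R g t)) =
      (\<lambda>t. indicator {a..} t *\<^sub>R (p t * g t))"
    by (auto simp: fun_eq_iff indicator_def)
  finally show "set_borel_measurable lborel {a..} (\<lambda>t. p t * g t)"
    by (simp add: set_borel_measurable_def)
  show "AE t in lborel. t \<in> {a..} \<longrightarrow> norm (p t * g t) \<le> norm (g t)"
    using p(2) by (intro AE_I2) (auto simp: abs_mult intro!: mult_left_le_one_le)
qed

lemma average_at_right_tendsto:
  fixes h :: "real \<Rightarrow> real"
  assumes h: "set_integrable lborel {0..} h" and lim: "(h \<longlongrightarrow> h 0) (at_right 0)"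
  shows "((\<lambda>\<epsilon>. (LINT s:{0..<\<epsilon>}|lborel. h s) / \<epsilon>) \<longlongrightarrow> h 0) (at_right 0)"
proof (rule tendstoI)
  fix e :: real assume e: "0 < e"
  then have "\<forall>\<^sub>F s in at_right 0. dist (h s) (h 0) < e / 2"
    using lim by (intro tendstoD) auto
  then obtain b where b: "0 < b" "\<And>s. 0 < s \<Longrightarrow> s < b \<Longrightarrow> dist (h s) (h 0) < e / 2"
    unfolding eventually_at_right_field by auto
  have near: "h s \<le> h 0 + e / 2" "h 0 - e / 2 \<le> h s" if "0 \<le> s" "s < b" for s
  proof -
    have "\<bar>h s - h 0\<bar> < e / 2"
      using b(2)[of s] that e by (cases "s = 0") (auto simp: dist_real_def)
    then show "h s \<le> h 0 + e / 2" "h 0 - e / 2 \<le> h s" by linarith+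
  qed
  have "dist ((LINT s:{0..<\<epsilon>}|lborel. h s) / \<epsilon>) (h 0) < e" if \<epsilon>: "0 < \<epsilon>" "\<epsilon> < b" for \<epsilon>
  proof -
    have const: "set_integrable lborel {0..<\<epsilon>} (\<lambda>_. c :: real)" "(LINT s:{0..<\<epsilon>}|lborel. c) = \<epsilon> * c" for c
      using \<epsilon> by (auto simp: set_integrable_def set_lebesgue_integral_def integrable_mult_left_iff)
    have int: "set_integrable lborel {0..<\<epsilon>} h"
      by (rule set_integrable_subset[OF h]) auto
    have "(LINT s:{0..<\<epsilon>}|lborel. h s) \<le> (LINT s:{0..<\<epsilon>}|lborel. h 0 + e / 2)"
      by (intro set_integral_mono int const near) (use \<epsilon> in auto)
    moreover have "(LINT s:{0..<\<epsilon>}|lborel. h 0 - e / 2) \<le> (LINT s:{0..<\<epsilon>}|lborel. h s)"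
      by (intro set_integral_mono int const near) (use \<epsilon> in auto)
    ultimately have "(LINT s:{0..<\<epsilon>}|lborel. h s) / \<epsilon> \<le> h 0 + e / 2" "h 0 - e / 2 \<le> (LINT s:{0..<\<epsilon>}|lborel. h s) / \<epsilon>"
      unfolding const(2) using \<epsilon> by (simp_all add: pos_divide_le_eq pos_le_divide_eq mult.commute)
    then show ?thesis using e by (simp add: dist_real_def abs_less_iff)
  qed
  then show "\<forall>\<^sub>F \<epsilon> in at_right 0. dist ((LINT s:{0..<\<epsilon>}|lborel. h s) / \<epsilon>) (h 0) < e"
    unfolding eventually_at_right_field using b(1) by blast
qed

text \<open>The shift sits on \<open>p\<close>, which is continuous and bounded by 1, and not on
  \<open>g\<close>, which is merely integrable; hence the absolute value of \<open>g\<close>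
  dominates. Applied to transition probabilities and rewards, this shows that continuation values at
  \<epsilon> tend to the values at 0.\<close>

lemma shifted_integral_tendsto:
  fixes p g :: "real \<Rightarrow> real"
  assumes p: "continuous_on {0..} p" "\<And>t. 0 \<le> t \<Longrightarrow> \<bar>p t\<bar> \<le> 1"
    and g: "set_integrable lborel {0..} g"
  shows "((\<lambda>\<epsilon>. LINT s:{\<epsilon>..}|lborel. p (s - \<epsilon>) * g s) \<longlongrightarrow> (LINT s:{0..}|lborel. p s * g s)) (at_right 0)"
proof (rule tendsto_at_right_sequentially[of 0 1])
  fix S :: "nat \<Rightarrow> real" assume S: "\<And>n. 0 < S n" "S \<longlonglongrightarrow> 0"
  have meas: "(\<lambda>s. indicator {a..} s *\<^sub>R (p (s - a) * g s)) \<in> borel_measurable lborel" if "0 \<le> a" for a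
  proof -
    have "set_integrable lborel {a..} g"
      by (rule set_integrable_subset[OF g]) (use that in auto)
    then have "set_integrable lborel {a..} (\<lambda>s. p (s - a) * g s)"
      by (intro set_integrable_mult_bounded continuous_on_compose2[OF p(1)] p(2))
        (auto intro!: continuous_intros)
    then show ?thesis
      unfolding set_integrable_def by (rule borel_measurable_integrable)
  qed
  show "(\<lambda>n. LINT s:{S n..}|lborel. p (s - S n) * g s) \<longlonglongrightarrow> (LINT s:{0..}|lborel. p s * g s)"
    unfolding set_lebesgue_integral_def
  proof (rule integral_dominated_convergence[where w = "\<lambda>s. norm (indicator {0..} s *\<^sub>R g s)"])
    show "integrable lborel (\<lambda>s. norm (indicator {0..} s *\<^sub>R g s))"
      using g unfolding set_integrable_def by (rule integrable_norm)
    show "AE s in lborel. (\<lambda>n. indicator {S n..} s *\<^sub>R (p (s - S n) * g s)) \<longlonglongrightarrow> indicator {0..} s *\<^sub>R (p s * g s)"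
      \<comment> \<open>At \<open>s\<close> = 0 every indicator of \<open>{S n..}\<close> is 0 while
        that of \<open>{0..}\<close> is 1, so this one point has to be discarded.\<close>
      using AE_lborel_singleton[of 0]
    proof eventually_elim
      case (elim s)
      show ?case
      proof (cases "0 < s")
        case True
        then have ev: "\<forall>\<^sub>F n in sequentially. S n < s"
          using S(2) by (intro order_tendstoD)
        have "(\<lambda>n. p (s - S n)) \<longlonglongrightarrow> p s"
        proof (rule continuous_on_tendsto_compose[OF p(1)])
          show "(\<lambda>n. s - S n) \<longlonglongrightarrow> s"
            using tendsto_diff[OF tendsto_const S(2)] by simp
          show "\<forall>\<^sub>F n in sequentially. s - S n \<in> {0..}"
            using ev by eventually_elim auto
        qed (use True in auto)
        then have "(\<lambda>n. p (s - S n) * g s) \<longlonglongrightarrow> p s * g s"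
          by (intro tendsto_intros)
        then have "(\<lambda>n. indicator {S n..} s *\<^sub>R (p (s - S n) * g s)) \<longlonglongrightarrow> p s * g s"
          by (rule Lim_transform_eventually) (use ev in eventually_elim, auto)
        then show ?thesis using True by simp
      next
        case False
        with elim S(1) have "s < 0" "s < S n" for n
          by (auto intro: less_trans[of s 0 "S n"])
        then show ?thesis by (simp add: not_le)
      qed
    qed
    show "AE s in lborel. norm (indicator {S n..} s *\<^sub>R (p (s - S n) * g s)) \<le> norm (indicator {0..} s *\<^sub>R g s)" for n
      using p(2) S(1)[of n] by (intro AE_I2) (auto simp: indicator_def abs_mult intro!: mult_left_le_one_le)
    show "(\<lambda>s. indicator {0..} s *\<^sub>R (p s * g s)) \<in> borel_measurable lborel"
      using meas[of 0] by simp
    show "(\<lambda>s. indicator {S n..} s *\<^sub>R (p (s - S n) * g s)) \<in> borel_measurable lborel" for n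
      using meas[of "S n"] S(1)[of n] by simp
  qed
qed simp

text \<open>Prepares Fubini in two places: for the event that a chain is in a given state, with
  \<open>N\<close> the law of the paths, and for the reward as a function of time and action, with
  \<open>N\<close> an action distribution. Both are given as measurable at each fixed time only. The
  \<open>max 0\<close> extends the function to negative times, where nothing is assumed of
  \<open>F\<close>.\<close>

lemma right_continuous_joint_measurable:
  fixes F :: "real \<Rightarrow> 'a \<Rightarrow> real"
  assumes meas: "\<And>t. 0 \<le> t \<Longrightarrow> F t \<in> borel_measurable N"
    and lim: "\<And>t x. 0 \<le> t \<Longrightarrow> x \<in> space N \<Longrightarrow> ((\<lambda>s. F s x) \<longlongrightarrow> F t x) (at_right t)"
  shows "(\<lambda>(t, x). F (max 0 t) x) \<in> borel_measurable (lborel \<Otimes>\<^sub>M N)"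
proof -
  \<comment> \<open>Approximate \<open>t\<close> by the grid point of mesh \<open>1 / Suc n\<close> strictly to its right.\<close>
  define g where "g n t = nat \<lfloor>real (Suc n) * max 0 t\<rfloor>" for n :: nat and t :: real
  have [measurable]: "g n \<in> measurable lborel (count_space UNIV)" for n
    unfolding g_def by measurable
  have [measurable]: "F (real (Suc k) / real (Suc n)) \<in> borel_measurable N" for k n
    by (rule meas) simp
  define G where "G n z = F (real (Suc (g n (fst z))) / real (Suc n)) (snd z)" for n and z :: "real \<times> 'a"
  have [measurable]: "G n \<in> borel_measurable (lborel \<Otimes>\<^sub>M N)" for n
    unfolding G_def
    by (rule measurable_compose_countable[where f = "\<lambda>k z. F (real (Suc k) / real (Suc n)) (snd z)"
        and g = "\<lambda>z. g n (fst z)"]) measurable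
  show ?thesis
  proof (rule borel_measurable_LIMSEQ_real[where u = G])
    fix z :: "real \<times> 'a" assume z: "z \<in> space (lborel \<Otimes>\<^sub>M N)"
    define t where "t = max 0 (fst z)"
    define r where "r n = real (Suc (g n (fst z))) / real (Suc n)" for n
    have g: "real (g n (fst z)) \<le> real (Suc n) * t" "real (Suc n) * t < real (Suc (g n (fst z)))" for n
    proof -
      have "real (g n (fst z)) = of_int \<lfloor>real (Suc n) * t\<rfloor>"
        by (simp add: g_def t_def)
      then show "real (g n (fst z)) \<le> real (Suc n) * t" "real (Suc n) * t < real (Suc (g n (fst z)))"
        by linarith+
    qed
    have r: "t < r n" "r n \<le> t + 1 / real (Suc n)" for n
    proof -
      show "t < r n"
        using g(2)[of n] by (simp add: r_def pos_less_divide_eq mult.commute del: of_nat_Suc)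
      have "real (g n (fst z)) / real (Suc n) \<le> t"
        using g(1)[of n] by (simp add: pos_divide_le_eq mult.commute del: of_nat_Suc)
      then show "r n \<le> t + 1 / real (Suc n)"
        by (simp add: r_def add_divide_distrib)
    qed
    have "r \<longlonglongrightarrow> t"
    proof (rule tendsto_sandwich[of "\<lambda>_. t" r _ "\<lambda>n. t + 1 / real (Suc n)"])
      show "(\<lambda>n. t + 1 / real (Suc n)) \<longlonglongrightarrow> t"
        using tendsto_add[OF tendsto_const LIMSEQ_Suc[OF lim_1_over_n]] by simp
    qed (use r in \<open>auto intro!: always_eventually less_imp_le\<close>)
    then have "filterlim r (at_right t) sequentially"
      unfolding filterlim_at using r(1) by (auto intro!: always_eventually)
    moreover have "((\<lambda>s. F s (snd z)) \<longlongrightarrow> F t (snd z)) (at_right t)"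
      using z by (intro lim) (auto simp: t_def space_pair_measure)
    ultimately show "(\<lambda>n. G n z) \<longlonglongrightarrow> (case z of (t, x) \<Rightarrow> F (max 0 t) x)"
      unfolding G_def r_def t_def by (auto simp: case_prod_unfold dest: filterlim_compose)
  qed measurable
qed

section \<open>Expected rewards of Markov chains\<close>

lemma markov_chain_marginal:
  assumes chain: "markov_chain M X A i"
  obtains P where "transition_function P" "has_generator P A"
    "\<And>t j. 0 \<le> t \<Longrightarrow> measure M {\<omega> \<in> space M. X t \<omega> = j} = P 0 t $ i $ j"
proof -
  interpret prob_space M using chain by (simp add: markov_chain_def)
  obtain P where P: "transition_function P" "has_generator P A" and step:
    "\<And>(n::nat) t x. 0 \<le> t 0 \<Longrightarrow> (\<forall>k\<le>n. t k \<le> t (Suc k)) \<Longrightarrow>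
           measure M {\<omega>\<in>space M. \<forall>k\<le>Suc n. X (t k) \<omega> = x k} =
           measure M {\<omega>\<in>space M. \<forall>k\<le>n. X (t k) \<omega> = x k} * P (t n) (t (Suc n)) $ x n $ x (Suc n)"
    using chain unfolding markov_chain_def by blast
  have start: "AE \<omega> in M. X 0 \<omega> = i" and [measurable]: "X 0 \<in> measurable M (count_space UNIV)"
    using chain by (auto simp: markov_chain_def)
  have "measure M {\<omega> \<in> space M. X t \<omega> = j} = P 0 t $ i $ j" if t: "0 \<le> t" for t j
  proof -
    have [measurable]: "X t \<in> measurable M (count_space UNIV)"
      using chain t by (auto simp: markov_chain_def)
    have "measure M {\<omega> \<in> space M. X t \<omega> = j} = measure M {\<omega> \<in> space M. X 0 \<omega> = i \<and> X t \<omega> = j}"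
      by (rule measure_eq_AE) (use start in auto)
    \<comment> \<open>The Markov property with \<open>n\<close> = 0 and the time grid 0,
      \<open>t\<close>; the states prescribed at these times are \<open>i\<close> and
      \<open>j\<close>.\<close>
    also have "\<dots> = measure M {\<omega> \<in> space M. X 0 \<omega> = i} * P 0 t $ i $ j"
      using step[of "\<lambda>k. if k = 0 then 0 else t" 0 "\<lambda>k. if k = 0 then i else j"] t
      by (simp add: le_Suc_eq all_conj_distrib conj_commute)
    also have "measure M {\<omega> \<in> space M. X 0 \<omega> = i} = 1"
      using prob_Collect_eq_1[of "\<lambda>\<omega>. X 0 \<omega> = i"] start by simp
    finally show ?thesis by simp
  qed
  with P that show ?thesis by blast
qed

text \<open>Splitting the reward by the current state turns it into a finite sum of products of the
  indicator of a state and a function of time alone. The indicators are jointly measurable because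
  right-continuous paths in a discrete space are constant just after each time, so Fubini applies to
  every summand.\<close>

lemma markov_chain_expected_integral:
  fixes G :: "real \<Rightarrow> 's::finite \<Rightarrow> real"
  assumes chain: "markov_chain M X A i"
    and G: "\<And>j. set_integrable lborel {0..} (\<lambda>s. G s j)"
  shows "(\<integral>\<omega>. (LINT s:{0..}|lborel. G s (X s \<omega>)) \<partial>M) =
    (\<Sum>j\<in>UNIV. LINT s:{0..}|lborel. measure M {\<omega> \<in> space M. X s \<omega> = j} * G s j)"
proof -
  interpret prob_space M using chain by (simp add: markov_chain_def)
  interpret pair_sigma_finite lborel M ..
  \<comment> \<open>The chain is constrained at nonnegative times only; \<open>max 0 s\<close> keeps
    the first factor measurable where the indicator of \<open>{0..}\<close> vanishes.\<close>
  define Z where "Z j s \<omega> = of_bool (X (max 0 s) \<omega> = j) * (indicator {0..} s * G s j)" for j s \<omega>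
  have [measurable]: "(\<lambda>s. indicator {0..} s * G s j) \<in> borel_measurable lborel" for j
    using borel_measurable_integrable[OF G[of j, unfolded set_integrable_def]] by simp
  have X_meas: "X t \<in> measurable M (count_space UNIV)" if "0 \<le> t" for t
    using chain that by (auto simp: markov_chain_def)
  have "(\<lambda>(s, \<omega>). of_bool (X (max 0 s) \<omega> = j) :: real) \<in> borel_measurable (lborel \<Otimes>\<^sub>M M)" for j
  proof (rule right_continuous_joint_measurable)
    show "(\<lambda>\<omega>. of_bool (X t \<omega> = j)) \<in> borel_measurable M" if "0 \<le> t" for t
      using X_meas[OF that] by measurable
    show "((\<lambda>s. of_bool (X s \<omega> = j) :: real) \<longlongrightarrow> of_bool (X t \<omega> = j)) (at_right t)"
      if "0 \<le> t" "\<omega> \<in> space M" for t \<omega>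
    proof (rule tendsto_eventually)
      have "\<forall>\<^sub>F s in at_right t. X s \<omega> = X t \<omega>"
        using chain that by (auto simp: markov_chain_def)
      then show "\<forall>\<^sub>F s in at_right t. of_bool (X s \<omega> = j) = (of_bool (X t \<omega> = j) :: real)"
        by eventually_elim simp
    qed
  qed
  then have [measurable]: "(\<lambda>z. of_bool (X (max 0 (fst z)) (snd z) = j) :: real) \<in> borel_measurable (lborel \<Otimes>\<^sub>M M)" for j
    by (simp add: case_prod_unfold)
  have Z_int: "integrable (lborel \<Otimes>\<^sub>M M) (case_prod (Z j))" for j
  proof (rule Bochner_Integration.integrable_bound)
    show "integrable (lborel \<Otimes>\<^sub>M M) (\<lambda>(s, \<omega>). indicator {0..} s * G s j)"
      using G[of j] by (intro Fubini_integrable) (auto simp: set_integrable_def prob_space)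
    show "case_prod (Z j) \<in> borel_measurable (lborel \<Otimes>\<^sub>M M)"
      unfolding Z_def case_prod_unfold by measurable
  qed (auto simp: Z_def)
  have pointwise: "indicator {0..} s * G s (X s \<omega>) = (\<Sum>j\<in>UNIV. Z j s \<omega>)" for s \<omega>
  proof -
    have "Z j s \<omega> = (if X (max 0 s) \<omega> = j then indicator {0..} s * G s j else 0)" for j
      by (simp add: Z_def)
    then show ?thesis by (cases "0 \<le> s") simp_all
  qed
  have Z_mean: "(\<integral>\<omega>. Z j s \<omega> \<partial>M) = indicator {0..} s * (measure M {\<omega> \<in> space M. X s \<omega> = j} * G s j)" for j s
  proof -
    have "(\<integral>\<omega>. of_bool (X s \<omega> = j) \<partial>M) = (\<integral>\<omega>. indicator {\<omega>. X s \<omega> = j} \<omega> \<partial>M :: real)"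
      by (intro Bochner_Integration.integral_cong) (auto simp: indicator_def)
    also have "\<dots> = measure M {\<omega> \<in> space M. X s \<omega> = j}"
      by (simp add: Int_def conj_commute)
    finally show ?thesis
      by (cases "0 \<le> s") (simp_all add: Z_def max_def)
  qed
  have "(\<integral>\<omega>. (LINT s:{0..}|lborel. G s (X s \<omega>)) \<partial>M) = (\<integral>\<omega>. (\<integral>s. (\<Sum>j\<in>UNIV. Z j s \<omega>) \<partial>lborel) \<partial>M)"
    by (simp add: set_lebesgue_integral_def pointwise)
  also have "\<dots> = (\<integral>s. (\<integral>\<omega>. (\<Sum>j\<in>UNIV. Z j s \<omega>) \<partial>M) \<partial>lborel)"
    using Z_int by (intro Fubini_integral) (simp add: case_prod_unfold)
  also have "\<dots> = (\<integral>s. (\<Sum>j\<in>UNIV. indicator {0..} s * (measure M {\<omega> \<in> space M. X s \<omega> = j} * G s j)) \<partial>lborel)"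
  proof (rule Bochner_Integration.integral_cong[OF refl])
    fix s :: real
    note Z_mean
    moreover have [measurable]: "X (max 0 s) \<in> measurable M (count_space UNIV)"
      by (rule X_meas) simp
    then have "integrable M (Z j s)" for j
      unfolding Z_def[abs_def]
      by (intro integrable_const_bound[where B = "\<bar>G s j\<bar>"]) (auto simp: indicator_def)
    ultimately show "(\<integral>\<omega>. (\<Sum>j\<in>UNIV. Z j s \<omega>) \<partial>M) =
      (\<Sum>j\<in>UNIV. indicator {0..} s * (measure M {\<omega> \<in> space M. X s \<omega> = j} * G s j))"
      by (simp add: Bochner_Integration.integral_sum)
  qed
  also have "\<dots> = (\<Sum>j\<in>UNIV. LINT s:{0..}|lborel. measure M {\<omega> \<in> space M. X s \<omega> = j} * G s j)"
    unfolding set_lebesgue_integral_def real_scaleR_def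
  proof (rule Bochner_Integration.integral_sum)
    fix j
    show "integrable lborel (\<lambda>s. indicator {0..} s * (measure M {\<omega> \<in> space M. X s \<omega> = j} * G s j))"
      using integrable_fst[OF Z_int[of j]] by (simp add: Z_mean)
  qed
  finally show ?thesis .
qed

section \<open>Entropy and the Gibbs variational principle\<close>

text \<open>Nonnegativity of relative entropy with its equality case. By \<open>mass\<close>,
  including \<open>\<gamma> x - \<rho> x\<close> in the integrand leaves the integral unchanged, but
  turns the integrand into \<open>\<rho> x * (r - 1 - ln r)\<close> with
  \<open>r = \<gamma> x / \<rho> x\<close> where \<rho> is positive. This is nonnegative and
  vanishes only for \<open>r\<close> = 1.\<close>

lemma gibbs_inequality:
  fixes \<gamma> \<rho> :: "'a \<Rightarrow> real"
  assumes int: "integrable N \<gamma>" "integrable N \<rho>"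
    and int_ln: "integrable N (\<lambda>x. ln (\<gamma> x) * \<rho> x)" "integrable N (\<lambda>x. ln (\<rho> x) * \<rho> x)"
    and pos: "\<And>x. x \<in> space N \<Longrightarrow> 0 < \<gamma> x" "\<And>x. x \<in> space N \<Longrightarrow> 0 \<le> \<rho> x"
    and mass: "(\<integral>x. \<rho> x \<partial>N) = (\<integral>x. \<gamma> x \<partial>N)"
  shows "(\<integral>x. ln (\<gamma> x) * \<rho> x \<partial>N) \<le> (\<integral>x. ln (\<rho> x) * \<rho> x \<partial>N)"
    and "(\<integral>x. ln (\<gamma> x) * \<rho> x \<partial>N) = (\<integral>x. ln (\<rho> x) * \<rho> x \<partial>N) \<Longrightarrow> AE x in N. \<rho> x = \<gamma> x"
proof -
  define \<phi> where "\<phi> x = \<gamma> x - \<rho> x - (ln (\<gamma> x) * \<rho> x - ln (\<rho> x) * \<rho> x)" for x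
  have \<phi>: "0 \<le> \<phi> x" "\<phi> x = 0 \<Longrightarrow> \<rho> x = \<gamma> x" if x: "x \<in> space N" for x
  proof -
    have "0 \<le> \<phi> x \<and> (\<phi> x = 0 \<longrightarrow> \<rho> x = \<gamma> x)"
    proof (cases "\<rho> x = 0")
      \<comment> \<open>Here both products with \<rho> vanish and \<open>\<phi> x\<close> reduces to
        \<open>\<gamma> x\<close>, which is strictly positive, so the equality case cannot
        occur.\<close>
      case True
      then show ?thesis using pos[OF x] by (simp add: \<phi>_def)
    next
      case False
      with pos[OF x] have p: "0 < \<rho> x" "0 < \<gamma> x" by auto
      have eq: "\<phi> x = \<rho> x * (\<gamma> x / \<rho> x - 1 - ln (\<gamma> x / \<rho> x))"
        using p by (simp add: \<phi>_def ln_div field_simps)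
      have "ln (\<gamma> x / \<rho> x) \<le> \<gamma> x / \<rho> x - 1"
        using p by (intro ln_le_minus_one) simp
      moreover have "\<gamma> x / \<rho> x = 1" if "ln (\<gamma> x / \<rho> x) = \<gamma> x / \<rho> x - 1"
        using p that by (intro ln_eq_minus_one) auto
      ultimately show ?thesis
        unfolding eq using p by auto
    qed
    then show "0 \<le> \<phi> x" "\<phi> x = 0 \<Longrightarrow> \<rho> x = \<gamma> x" by auto
  qed
  have \<phi>_int: "integrable N \<phi>"
    unfolding \<phi>_def using int int_ln by auto
  have \<phi>_eq: "(\<integral>x. \<phi> x \<partial>N) = (\<integral>x. ln (\<rho> x) * \<rho> x \<partial>N) - (\<integral>x. ln (\<gamma> x) * \<rho> x \<partial>N)"
    unfolding \<phi>_def using int int_ln mass by simp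
  have "0 \<le> (\<integral>x. \<phi> x \<partial>N)"
    using \<phi>(1) by (intro integral_nonneg_AE) auto
  then show "(\<integral>x. ln (\<gamma> x) * \<rho> x \<partial>N) \<le> (\<integral>x. ln (\<rho> x) * \<rho> x \<partial>N)"
    by (simp add: \<phi>_eq)
  assume "(\<integral>x. ln (\<gamma> x) * \<rho> x \<partial>N) = (\<integral>x. ln (\<rho> x) * \<rho> x \<partial>N)"
  then have "AE x in N. \<phi> x = 0"
    using integral_nonneg_eq_0_iff_AE[OF \<phi>_int] \<phi>(1) \<phi>_eq by auto
  then show "AE x in N. \<rho> x = \<gamma> x"
    using AE_space by eventually_elim (use \<phi>(2) in blast)
qed

section \<open>Probability densities on the action set and their entropy\<close>

lemma finite_measure_leb_on: "compact U \<Longrightarrow> finite_measure (leb_on U)"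
  using emeasure_compact_finite[of U]
  by (intro finite_measureI) (auto simp: emeasure_restrict_space borel_compact space_restrict_space)

lemma space_leb_on: "space (leb_on U) = U"
  by (simp add: space_restrict_space)

lemma sets_leb_on: "sets (leb_on U) = sets (restrict_space borel U)"
  by (rule sets_restrict_space_cong) simp

lemma prob_densitiesD:
  assumes "\<rho> \<in> prob_densities U"
  shows "\<rho> \<in> borel_measurable (leb_on U)" "u \<in> U \<Longrightarrow> 0 \<le> \<rho> u"
    "integrable (leb_on U) \<rho>" "(\<integral>u. \<rho> u \<partial>leb_on U) = 1"
proof -
  show meas: "\<rho> \<in> borel_measurable (leb_on U)" and "u \<in> U \<Longrightarrow> 0 \<le> \<rho> u"
    using assms by (auto simp: prob_densities_def)
  have nonneg: "AE u in leb_on U. 0 \<le> \<rho> u"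
    using assms by (intro AE_I2) (auto simp: prob_densities_def space_leb_on)
  have "has_bochner_integral (leb_on U) \<rho> 1"
    using assms by (intro has_bochner_integral_nn_integral meas nonneg) (auto simp: prob_densities_def)
  then show "integrable (leb_on U) \<rho>" "(\<integral>u. \<rho> u \<partial>leb_on U) = 1"
    by (auto simp: has_bochner_integral_iff)
qed

lemma measure_of_density_prob:
  assumes "\<rho> \<in> prob_densities U"
  shows "measure_of_density U \<rho> \<in> prob_measures U"
proof -
  have "prob_space (density (leb_on U) (\<lambda>u. ennreal (\<rho> u)))"
  proof (rule prob_spaceI)
    have "emeasure (density (leb_on U) (\<lambda>u. ennreal (\<rho> u))) U =
        (\<integral>\<^sup>+ u. ennreal (\<rho> u) * indicator U u \<partial>leb_on U)"
      using assms sets.top[of "leb_on U"]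
      by (intro emeasure_density) (auto simp: prob_densities_def space_leb_on)
    also have "\<dots> = (\<integral>\<^sup>+ u. ennreal (\<rho> u) \<partial>leb_on U)"
      by (rule nn_integral_cong) (simp add: space_leb_on)
    finally show "emeasure (density (leb_on U) (\<lambda>u. ennreal (\<rho> u)))
        (space (density (leb_on U) (\<lambda>u. ennreal (\<rho> u)))) = 1"
      using assms by (simp add: space_leb_on prob_densities_def)
  qed
  then show ?thesis
    by (simp add: prob_measures_def measure_of_density_def sets_leb_on)
qed

lemma integral_measure_of_density:
  fixes g :: "real ^ 'l \<Rightarrow> real"
  assumes "\<rho> \<in> prob_densities U" "g \<in> borel_measurable (restrict_space borel U)"
  shows "(\<integral>u. g u \<partial>measure_of_density U \<rho>) = (\<integral>u. g u * \<rho> u \<partial>leb_on U)"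
proof -
  have [measurable]: "g \<in> borel_measurable (leb_on U)"
    using assms(2) measurable_cong_sets[OF sets_leb_on refl] by blast
  show ?thesis
    unfolding measure_of_density_def
    using assms(1) by (subst integral_real_density)
      (auto intro!: AE_I2 simp: prob_densitiesD space_leb_on mult.commute)
qed

text \<open>The entropy of a measure is defined through its Radon-Nikodym derivative. Uniqueness of
  that derivative recovers an explicit density up to a null set, which is enough because the entropy
  integrals do not see null sets.\<close>

lemma density_of_measure_of_density:
  assumes "compact U" "\<rho> \<in> prob_densities U"
  shows "AE u in leb_on U. density_of U (measure_of_density U \<rho>) u = \<rho> u"
proof -
  interpret finite_measure "leb_on U" by (rule finite_measure_leb_on[OF assms(1)])
  have "AE u in leb_on U. ennreal (\<rho> u) = RN_deriv (leb_on U) (measure_of_density U \<rho>) u"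
    using prob_densitiesD(1)[OF assms(2)] by (intro RN_deriv_unique) (auto simp: measure_of_density_def)
  then show ?thesis
    using AE_space
  proof eventually_elim
    case (elim u)
    then show ?case
      using prob_densitiesD(2)[OF assms(2)] by (simp add: density_of_def space_leb_on flip: elim(1))
  qed
qed

lemma entropy_measure_of_density:
  assumes "compact U" "\<rho> \<in> prob_densities U"
  shows "entropy_measure U (measure_of_density U \<rho>) = entropy_density U \<rho>"
proof -
  note AE = density_of_measure_of_density[OF assms]
  have "(\<integral>\<^sup>+ u. h (density_of U (measure_of_density U \<rho>) u) \<partial>leb_on U) = (\<integral>\<^sup>+ u. h (\<rho> u) \<partial>leb_on U)" for h
    by (rule nn_integral_cong_AE) (use AE in eventually_elim, simp)
  from this[of "\<lambda>r. ennreal (- (ln r * r))"] this[of "\<lambda>r. ennreal (ln r * r)"] show ?thesis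
    by (simp add: entropy_measure_def entropy_density_def)
qed

text \<open>For \<open>r\<close> > 0 one has \<open>- (ln r * r) \<le> 1 - r\<close>, a consequence
  of \<open>ln x \<le> x - 1\<close>. Hence the first integral in the entropy is at most the volume
  of \<open>U\<close>, the value minus infinity can come from the second one only, and excluding it
  amounts to integrability.\<close>

lemma entropy_density_finite_iff:
  assumes U: "compact U" and \<rho>: "\<rho> \<in> prob_densities U"
  shows "- \<infinity> < entropy_density U \<rho> \<longleftrightarrow> integrable (leb_on U) (\<lambda>u. ln (\<rho> u) * \<rho> u)"
    and "integrable (leb_on U) (\<lambda>u. ln (\<rho> u) * \<rho> u) \<Longrightarrow>
      entropy_density U \<rho> = ereal (- (\<integral>u. ln (\<rho> u) * \<rho> u \<partial>leb_on U))"
proof -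
  interpret finite_measure "leb_on U" by (rule finite_measure_leb_on[OF U])
  note [measurable] = prob_densitiesD(1)[OF \<rho>]
  have bound: "- (ln (\<rho> u) * \<rho> u) \<le> 1" if "u \<in> U" for u
  proof (cases "\<rho> u = 0")
    case False
    then have p: "0 < \<rho> u" using prob_densitiesD(2)[OF \<rho> that] by simp
    have "ln (1 / \<rho> u) \<le> 1 / \<rho> u - 1" using p by (intro ln_le_minus_one) simp
    then have "- ln (\<rho> u) * \<rho> u \<le> (1 / \<rho> u - 1) * \<rho> u"
      using p by (intro mult_right_mono) (auto simp: ln_div)
    also have "(1 / \<rho> u - 1) * \<rho> u = 1 - \<rho> u" using p by (simp add: left_diff_distrib)
    finally show ?thesis using p by simp
  qed simp
  have "(\<integral>\<^sup>+ u. ennreal (- (ln (\<rho> u) * \<rho> u)) \<partial>leb_on U) \<le> (\<integral>\<^sup>+ u. 1 \<partial>leb_on U)"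
    using bound by (intro nn_integral_mono) (auto simp: space_leb_on)
  also have "\<dots> < \<infinity>" by (simp add: less_top[symmetric])
  finally have neg: "(\<integral>\<^sup>+ u. ennreal (- (ln (\<rho> u) * \<rho> u)) \<partial>leb_on U) < \<infinity>" .
  then obtain a where a: "(\<integral>\<^sup>+ u. ennreal (- (ln (\<rho> u) * \<rho> u)) \<partial>leb_on U) = ennreal a" "0 \<le> a"
    by (cases "(\<integral>\<^sup>+ u. ennreal (- (ln (\<rho> u) * \<rho> u)) \<partial>leb_on U)") auto
  show "- \<infinity> < entropy_density U \<rho> \<longleftrightarrow> integrable (leb_on U) (\<lambda>u. ln (\<rho> u) * \<rho> u)"
    unfolding real_integrable_def entropy_density_def a
    using a(2) by (cases "\<integral>\<^sup>+ u. ennreal (ln (\<rho> u) * \<rho> u) \<partial>leb_on U") auto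
  assume int: "integrable (leb_on U) (\<lambda>u. ln (\<rho> u) * \<rho> u)"
  then have "(\<integral>\<^sup>+ u. ennreal (ln (\<rho> u) * \<rho> u) \<partial>leb_on U) \<noteq> \<infinity>"
    by (simp add: real_integrable_def)
  then show "entropy_density U \<rho> = ereal (- (\<integral>u. ln (\<rho> u) * \<rho> u \<partial>leb_on U))"
    unfolding real_lebesgue_integral_def[OF int] entropy_density_def a
    using a(2) by (cases "\<integral>\<^sup>+ u. ennreal (ln (\<rho> u) * \<rho> u) \<partial>leb_on U") auto
qed

definition gibbs_density :: "(real ^ 'l) set \<Rightarrow> real \<Rightarrow> (real ^ 'l \<Rightarrow> real) \<Rightarrow> real ^ 'l \<Rightarrow> real" where
  "gibbs_density U lam a u = exp (1 / lam * a u) / (\<integral>v. exp (1 / lam * a v) \<partial>leb_on U)"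

text \<open>Since \<open>ln (\<gamma> u) = a u / lam - ln Z\<close>, the functional evaluated at a
  density \<rho> falls short of \<open>lam * ln Z\<close> by exactly \<open>lam\<close> times the
  entropy of \<rho> relative to \<gamma>. The optimal value is thus the scaled logarithm of the
  partition function \<open>Z\<close>, and the equality case of \<open>gibbs_inequality\<close>
  gives uniqueness.\<close>

lemma gibbs_variational_principle:
  fixes a :: "real ^ 'l \<Rightarrow> real"
  assumes U: "compact U" "0 < emeasure lborel U" and lam: "0 < lam"
    and a: "a \<in> borel_measurable (restrict_space borel U)" "\<forall>u\<in>U. \<bar>a u\<bar> \<le> C"
  defines "\<gamma> \<equiv> gibbs_density U lam a"
    and "Z \<equiv> (\<integral>u. exp (1 / lam * a u) \<partial>leb_on U)"
  shows gibbs_density_prob: "\<gamma> \<in> prob_densities U"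
    and gibbs_density_entropy: "integrable (leb_on U) (\<lambda>u. ln (\<gamma> u) * \<gamma> u)"
    and gibbs_density_value:
      "(\<integral>u. a u * \<gamma> u \<partial>leb_on U) - lam * (\<integral>u. ln (\<gamma> u) * \<gamma> u \<partial>leb_on U) = lam * ln Z"
    and gibbs_density_maximal: "\<And>\<rho>. \<rho> \<in> prob_densities U \<Longrightarrow> integrable (leb_on U) (\<lambda>u. ln (\<rho> u) * \<rho> u) \<Longrightarrow>
      (\<integral>u. a u * \<rho> u \<partial>leb_on U) - lam * (\<integral>u. ln (\<rho> u) * \<rho> u \<partial>leb_on U) \<le> lam * ln Z"
    and gibbs_density_unique: "\<And>\<rho>. \<rho> \<in> prob_densities U \<Longrightarrow> integrable (leb_on U) (\<lambda>u. ln (\<rho> u) * \<rho> u) \<Longrightarrow>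
      (\<integral>u. a u * \<rho> u \<partial>leb_on U) - lam * (\<integral>u. ln (\<rho> u) * \<rho> u \<partial>leb_on U) = lam * ln Z \<Longrightarrow>
      AE u in leb_on U. \<rho> u = \<gamma> u"
proof -
  interpret finite_measure "leb_on U" by (rule finite_measure_leb_on[OF U(1)])
  have [measurable]: "a \<in> borel_measurable (leb_on U)"
    using a(1) measurable_cong_sets[OF sets_leb_on refl] by blast
  have U_sets: "U \<in> sets borel" using U(1) by (rule borel_compact)
  have exp_le: "exp (1 / lam * a u) \<le> exp (1 / lam * C)" if "u \<in> U" for u
    using bspec[OF a(2) that] lam by (simp add: divide_right_mono)
  have exp_int: "integrable (leb_on U) (\<lambda>u. exp (1 / lam * a u))"
  proof (rule integrable_const_bound)
    show "AE u in leb_on U. norm (exp (1 / lam * a u)) \<le> exp (1 / lam * C)"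
      using exp_le by (intro AE_I2) (simp add: space_leb_on)
  qed measurable
  have Z_pos: "0 < Z"
  proof -
    have "Z \<noteq> 0"
    proof
      assume "Z = 0"
      then have "AE u in leb_on U. exp (1 / lam * a u) = 0"
        unfolding Z_def using integral_nonneg_eq_0_iff_AE[OF exp_int] by simp
      then have "emeasure (leb_on U) (space (leb_on U)) = 0"
        by (simp add: AE_iff_null) (auto simp: null_sets_def)
      then show False using U(2) U_sets by (simp add: space_leb_on emeasure_restrict_space)
    qed
    moreover have "0 \<le> Z" unfolding Z_def by (rule integral_nonneg_AE) simp
    ultimately show ?thesis by simp
  qed
  have \<gamma>_eq: "\<gamma> u = exp (1 / lam * a u) / Z" for u
    by (simp add: \<gamma>_def gibbs_density_def Z_def)
  have \<gamma>_pos: "0 < \<gamma> u" for u using Z_pos by (simp add: \<gamma>_eq)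
  have \<gamma>_int: "integrable (leb_on U) \<gamma>" unfolding \<gamma>_eq[abs_def] using exp_int by simp
  have \<gamma>_one: "(\<integral>u. \<gamma> u \<partial>leb_on U) = 1"
  proof -
    have "(\<integral>u. \<gamma> u \<partial>leb_on U) = Z / Z"
      unfolding \<gamma>_eq Z_def by simp
    then show ?thesis using Z_pos by simp
  qed
  show \<gamma>_prob: "\<gamma> \<in> prob_densities U"
    unfolding prob_densities_def using \<gamma>_int \<gamma>_pos \<gamma>_one
    by (auto simp: nn_integral_eq_integral less_imp_le)
  have ln_\<gamma>: "ln (\<gamma> u) = a u / lam - ln Z" for u
    using Z_pos by (simp add: \<gamma>_eq ln_div)
  have a_int: "integrable (leb_on U) (\<lambda>u. a u * \<rho> u)" if "\<rho> \<in> prob_densities U" for \<rho>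
  proof (rule Bochner_Integration.integrable_bound)
    note [measurable] = prob_densitiesD(1)[OF that]
    show "integrable (leb_on U) (\<lambda>u. C * \<rho> u)" using prob_densitiesD(3)[OF that] by simp
    show "(\<lambda>u. a u * \<rho> u) \<in> borel_measurable (leb_on U)" by measurable
    show "AE u in leb_on U. norm (a u * \<rho> u) \<le> norm (C * \<rho> u)"
      using a(2) by (intro AE_I2) (force simp: space_leb_on abs_mult intro!: mult_right_mono)
  qed
  have ln_int: "integrable (leb_on U) (\<lambda>u. ln (\<gamma> u) * \<rho> u)"
    and ln_val: "lam * (\<integral>u. ln (\<gamma> u) * \<rho> u \<partial>leb_on U) = (\<integral>u. a u * \<rho> u \<partial>leb_on U) - lam * ln Z"
    if "\<rho> \<in> prob_densities U" for \<rho>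
  proof -
    have eq: "(\<lambda>u. ln (\<gamma> u) * \<rho> u) = (\<lambda>u. a u * \<rho> u / lam - ln Z * \<rho> u)"
      by (simp add: fun_eq_iff ln_\<gamma> algebra_simps)
    show "integrable (leb_on U) (\<lambda>u. ln (\<gamma> u) * \<rho> u)"
      unfolding eq using a_int[OF that] prob_densitiesD(3)[OF that] by simp
    show "lam * (\<integral>u. ln (\<gamma> u) * \<rho> u \<partial>leb_on U) = (\<integral>u. a u * \<rho> u \<partial>leb_on U) - lam * ln Z"
      unfolding eq using a_int[OF that] prob_densitiesD(3,4)[OF that] lam
      by (simp add: field_simps)
  qed
  show "integrable (leb_on U) (\<lambda>u. ln (\<gamma> u) * \<gamma> u)" by (rule ln_int[OF \<gamma>_prob])
  show "(\<integral>u. a u * \<gamma> u \<partial>leb_on U) - lam * (\<integral>u. ln (\<gamma> u) * \<gamma> u \<partial>leb_on U) = lam * ln Z"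
    using ln_val[OF \<gamma>_prob] by simp
  fix \<rho> assume \<rho>: "\<rho> \<in> prob_densities U" "integrable (leb_on U) (\<lambda>u. ln (\<rho> u) * \<rho> u)"
  note gibbs = gibbs_inequality[OF \<gamma>_int prob_densitiesD(3)[OF \<rho>(1)] ln_int[OF \<rho>(1)] \<rho>(2)]
  have "lam * (\<integral>u. ln (\<gamma> u) * \<rho> u \<partial>leb_on U) \<le> lam * (\<integral>u. ln (\<rho> u) * \<rho> u \<partial>leb_on U)"
    using lam \<gamma>_pos prob_densitiesD[OF \<rho>(1)] \<gamma>_one
    by (intro mult_left_mono gibbs(1)) (auto simp: space_leb_on)
  then show "(\<integral>u. a u * \<rho> u \<partial>leb_on U) - lam * (\<integral>u. ln (\<rho> u) * \<rho> u \<partial>leb_on U) \<le> lam * ln Z"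
    using ln_val[OF \<rho>(1)] by simp
  assume "(\<integral>u. a u * \<rho> u \<partial>leb_on U) - lam * (\<integral>u. ln (\<rho> u) * \<rho> u \<partial>leb_on U) = lam * ln Z"
  then have "lam * (\<integral>u. ln (\<gamma> u) * \<rho> u \<partial>leb_on U) = lam * (\<integral>u. ln (\<rho> u) * \<rho> u \<partial>leb_on U)"
    using ln_val[OF \<rho>(1)] by simp
  then show "AE u in leb_on U. \<rho> u = \<gamma> u"
    using lam \<gamma>_pos prob_densitiesD[OF \<rho>(1)] \<gamma>_one
    by (intro gibbs(2)) (auto simp: space_leb_on)
qed

text \<open>Turns the integrability hypothesis on the rates into the bound that the Gibbs principle
  asks of its exponent. A point mass at some \<open>u\<close> in \<open>U\<close> already reveals
  measurability of \<open>g\<close>; an unbounded \<open>g\<close> would fail to be integrable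
  against a suitable mixture of point masses.\<close>

lemma integrable_all_prob_measures:
  fixes g :: "real ^ 'l \<Rightarrow> real"
  assumes U: "U \<noteq> {}" and int: "\<And>\<mu>. \<mu> \<in> prob_measures U \<Longrightarrow> integrable \<mu> g"
  shows "g \<in> borel_measurable (restrict_space borel U)" and "\<exists>C. \<forall>u\<in>U. \<bar>g u\<bar> \<le> C"
proof -
  have sp: "space (restrict_space borel U) = U" by (simp add: space_restrict_space)
  obtain u where "u \<in> U" using U by blast
  then have "return (restrict_space borel U) u \<in> prob_measures U"
    unfolding prob_measures_def by (auto intro!: prob_space_return simp: sp)
  from borel_measurable_integrable[OF int[OF this]]
  show meas: "g \<in> borel_measurable (restrict_space borel U)" by simp
  show "\<exists>C. \<forall>u\<in>U. \<bar>g u\<bar> \<le> C"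
  proof (rule ccontr)
    assume "\<nexists>C. \<forall>u\<in>U. \<bar>g u\<bar> \<le> C"
    then have "\<forall>n. \<exists>u\<in>U. 4 ^ n < \<bar>g u\<bar>" by (meson not_le)
    then obtain w where w: "\<And>n. w n \<in> U" "\<And>n::nat. 4 ^ n < \<bar>g (w n)\<bar>" by metis
    \<comment> \<open>The image under \<open>w\<close> of a geometric law is a probability measure not integrating \<open>g\<close>.\<close>
    define p where "p = geometric_pmf (1 / 2)"
    have pmf: "pmf p n = (1 / 2) ^ Suc n" for n by (simp add: p_def)
    have w_meas: "w \<in> measurable (measure_pmf p) (restrict_space borel U)"
      using w(1) by (simp add: sp)
    have "distr (measure_pmf p) (restrict_space borel U) w \<in> prob_measures U"
      unfolding prob_measures_def using measure_pmf.prob_space_distr[OF w_meas] by simp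
    then have "integrable (measure_pmf p) (\<lambda>n. g (w n))"
      using int integrable_distr_eq[OF w_meas meas] by blast
    then have abs_int: "integrable (measure_pmf p) (\<lambda>n. \<bar>g (w n)\<bar>)" by (rule integrable_abs)
    \<comment> \<open>The growth \<open>4 ^ n\<close> beats the weight
      \<open>(1 / 2) ^ Suc n\<close>: the single atom \<open>n\<close> contributes at least
      \<open>2 ^ n / 2\<close>, which for this \<open>n\<close> already exceeds the whole
      integral.\<close>
    obtain n where n: "2 * (\<integral>n. \<bar>g (w n)\<bar> \<partial>p) < 2 ^ n"
      using real_arch_pow[of 2] by auto
    have "(1 / 2) ^ Suc n * 4 ^ n \<le> pmf p n * \<bar>g (w n)\<bar>"
      unfolding pmf using w(2)[of n] by (intro mult_left_mono) auto
    also have "\<dots> = (\<integral>k. indicator {n} k * \<bar>g (w k)\<bar> \<partial>p)"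
      by (subst integral_measure_pmf_real[where A = "{n}"]) (auto split: split_indicator_asm)
    also have "\<dots> \<le> (\<integral>k. \<bar>g (w k)\<bar> \<partial>p)"
      by (rule integral_mono[OF Bochner_Integration.integrable_bound[OF abs_int] abs_int])
        (auto simp: indicator_def)
    finally have "(1 / 2) ^ Suc n * 4 ^ n \<le> (\<integral>k. \<bar>g (w k)\<bar> \<partial>p)" .
    moreover have "(1 / 2) ^ Suc n * 4 ^ n = (2 ^ n / 2 :: real)"
      by (simp add: power_divide field_simps flip: power_mult_distrib)
    ultimately show False using n by simp
  qed
qed

section \<open>The control problem\<close>

text \<open>\<open>M_finite\<close> bounds the rewards on average over time and leaves the value at
  time 0 free. The bound \<open>f_bdd_near_0\<close> fills this gap: it makes \<open>f 0 i\<close>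
  integrable against every control, bounds the exponent of the Gibbs density, and dominates the mean
  rewards as time decreases to 0.\<close>

locale control_problem =
  fixes U :: "(real ^ 'l) set"
    and q :: "real ^ 'l \<Rightarrow> real ^ 's ^ 's::finite"
    and f :: "real \<Rightarrow> 's \<Rightarrow> real ^ 'l \<Rightarrow> real"
    and \<delta> :: "real \<Rightarrow> real"
    and lam :: real
    and M :: "(real \<Rightarrow> ('s, 'l) control) \<Rightarrow> 's \<Rightarrow> 'w measure"
    and X :: "(real \<Rightarrow> ('s, 'l) control) \<Rightarrow> 's \<Rightarrow> real \<Rightarrow> 'w \<Rightarrow> 's"
  assumes U_compact: "compact U"
    and U_pos: "0 < emeasure lborel U"
    and q_int: "\<And>\<mu> i j. \<mu> \<in> prob_measures U \<Longrightarrow> integrable \<mu> (\<lambda>u. q u $ i $ j)"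
    and f_meas: "\<And>t i. 0 \<le> t \<Longrightarrow> f t i \<in> borel_measurable (restrict_space borel U)"
    and f_bdd_near_0: "\<exists>\<epsilon>>0. \<exists>K. \<forall>t\<in>{0..\<epsilon>}. \<forall>i. \<forall>u\<in>U. \<bar>f t i u\<bar> \<le> K"
    and \<delta>_range: "\<And>t. 0 \<le> t \<Longrightarrow> \<delta> t \<in> {0..1}"
    and \<delta>_0: "\<delta> 0 = 1"
    and chains: "controlled_chains U q M X"
    and M_finite:
      "(\<integral>\<^sup>+ s\<in>{0..}. ((SUP i\<in>UNIV. SUP u\<in>U. ennreal \<bar>f s i u\<bar>) + ennreal (\<delta> s)) \<partial>lborel) < \<infinity>"
    and f_cont: "\<And>i u. u \<in> U \<Longrightarrow> continuous_on {0..} (\<lambda>t. f t i u)"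
    and \<delta>_cont: "continuous_on {0..} \<delta>"
    and lam_pos: "0 < lam"
begin

section \<open>Reward rates of a fixed action distribution as functions of time\<close>

definition reward_rate :: "(real ^ 'l) measure \<Rightarrow> real \<Rightarrow> 's \<Rightarrow> real" where
  "reward_rate \<mu> s i = mean_reward f \<mu> s i + lam * \<delta> s * real_of_ereal (entropy_measure U \<mu>)"

abbreviation J :: "(real \<Rightarrow> ('s, 'l) control) \<Rightarrow> 's \<Rightarrow> real" where
  "J \<equiv> value_at U f \<delta> lam M X"

lemma mean_reward_measurable:
  assumes "\<mu> \<in> prob_measures U"
  shows "(\<lambda>s. mean_reward f \<mu> (max 0 s) i) \<in> borel_measurable lborel"
proof -
  interpret prob_space \<mu> using assms by (simp add: prob_measures_def)
  have sets: "sets \<mu> = sets (restrict_space borel U)" using assms by (simp add: prob_measures_def)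
  have sp: "space \<mu> = U" using sets_eq_imp_space_eq[OF sets] by (simp add: space_restrict_space)
  have "(\<lambda>(t, u). f (max 0 t) i u) \<in> borel_measurable (lborel \<Otimes>\<^sub>M \<mu>)"
  proof (rule right_continuous_joint_measurable)
    show "f t i \<in> borel_measurable \<mu>" if "0 \<le> t" for t
      using f_meas[OF that] measurable_cong_sets[OF sets refl] by blast
    show "((\<lambda>s. f s i u) \<longlongrightarrow> f t i u) (at_right t)" if "0 \<le> t" "u \<in> space \<mu>" for t u
      using right_limit_of_continuous_on[OF f_cont that(1), of u i] that(2) sp by simp
  qed
  then show ?thesis
    unfolding mean_reward_def by (rule borel_measurable_lebesgue_integral)
qed

lemma reward_rate_integrable:
  assumes \<mu>: "\<mu> \<in> prob_measures U"
  shows "set_integrable lborel {0..} (\<lambda>s. reward_rate \<mu> s i)"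
proof -
  interpret prob_space \<mu> using \<mu> by (simp add: prob_measures_def)
  have sets: "sets \<mu> = sets (restrict_space borel U)" using \<mu> by (simp add: prob_measures_def)
  have sp: "space \<mu> = U" using sets_eq_imp_space_eq[OF sets] by (simp add: space_restrict_space)
  define H where "H = real_of_ereal (entropy_measure U \<mu>)"
  \<comment> \<open>Dividing by \<open>C\<close> makes both the mean reward and the entropy term fit
    under \<open>F s + \<delta> s\<close> with coefficients at most 1. Monotonicity alone then leads
    to \<open>M_finite\<close>, without splitting or rescaling an integral that contains an
    uncountable supremum.\<close>
  define C where "C = 1 + lam * \<bar>H\<bar>"
  have C: "1 \<le> C" "lam * \<bar>H\<bar> \<le> C" using lam_pos by (auto simp: C_def)
  define F where "F s = (SUP i\<in>UNIV. SUP u\<in>U. ennreal \<bar>f s i u\<bar>)" for s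
  have mean_le: "ennreal \<bar>mean_reward f \<mu> s i\<bar> \<le> F s" for s
  proof (cases "integrable \<mu> (f s i)")
    case True
    have "ennreal \<bar>mean_reward f \<mu> s i\<bar> \<le> (\<integral>\<^sup>+ u. ennreal \<bar>f s i u\<bar> \<partial>\<mu>)"
      unfolding mean_reward_def using integral_norm_bound_ennreal[OF True] by simp
    also have "\<dots> \<le> (\<integral>\<^sup>+ u. F s \<partial>\<mu>)"
    proof (rule nn_integral_mono)
      fix u assume "u \<in> space \<mu>"
      then have "ennreal \<bar>f s i u\<bar> \<le> (SUP u\<in>U. ennreal \<bar>f s i u\<bar>)"
        by (intro SUP_upper) (simp add: sp)
      also have "\<dots> \<le> F s" unfolding F_def by (rule SUP_upper) simp
      finally show "ennreal \<bar>f s i u\<bar> \<le> F s" .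
    qed
    also have "\<dots> = F s" by (simp add: emeasure_space_1)
    finally show ?thesis .
  next
    \<comment> \<open>The integral of a function that is not integrable has the default value
      0.\<close>
    case False
    then show ?thesis by (simp add: mean_reward_def not_integrable_integral_eq)
  qed
  define h where "h s = indicator {0..} s * (mean_reward f \<mu> s i + lam * \<delta> s * H) / C" for s
  have [measurable]: "(\<lambda>s. mean_reward f \<mu> (max 0 s) i) \<in> borel_measurable lborel"
    by (rule mean_reward_measurable[OF \<mu>])
  have [measurable]: "(\<lambda>s. indicator {0..} s *\<^sub>R \<delta> s) \<in> borel_measurable borel"
    using \<delta>_cont by (intro borel_measurable_continuous_on_indicator) auto
  have "h = (\<lambda>s. (indicator {0..} s * mean_reward f \<mu> (max 0 s) i
      + lam * (indicator {0..} s *\<^sub>R \<delta> s) * H) / C)"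
    by (auto simp: h_def fun_eq_iff indicator_def max_def)
  also have "\<dots> \<in> borel_measurable lborel" by measurable
  finally have h_meas: "h \<in> borel_measurable lborel" .
  have "(\<integral>\<^sup>+ s. ennreal (norm (h s)) \<partial>lborel) \<le> (\<integral>\<^sup>+ s\<in>{0..}. (F s + ennreal (\<delta> s)) \<partial>lborel)"
  proof (rule nn_integral_mono)
    fix s :: real
    show "ennreal (norm (h s)) \<le> (F s + ennreal (\<delta> s)) * indicator {0..} s"
    proof (cases "0 \<le> s")
      case True
      then have \<delta>: "0 \<le> \<delta> s" using \<delta>_range by auto
      have "norm (h s) = \<bar>mean_reward f \<mu> s i + lam * \<delta> s * H\<bar> / C"
        using True C(1) by (simp add: h_def)
      also have "\<dots> \<le> (\<bar>mean_reward f \<mu> s i\<bar> + lam * \<bar>H\<bar> * \<delta> s) / C"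
        using C(1) \<delta> lam_pos
        by (intro divide_right_mono order_trans[OF abs_triangle_ineq]) (auto simp: abs_mult)
      also have "\<dots> = \<bar>mean_reward f \<mu> s i\<bar> / C + lam * \<bar>H\<bar> / C * \<delta> s"
        by (simp add: add_divide_distrib)
      also have "\<dots> \<le> \<bar>mean_reward f \<mu> s i\<bar> + 1 * \<delta> s"
      proof (rule add_mono)
        show "\<bar>mean_reward f \<mu> s i\<bar> / C \<le> \<bar>mean_reward f \<mu> s i\<bar>"
          using C(1) by (simp add: divide_le_eq mult_left_le_one_le mult_le_cancel_left1)
        show "lam * \<bar>H\<bar> / C * \<delta> s \<le> 1 * \<delta> s"
          using C \<delta> by (intro mult_right_mono) (auto simp: divide_le_eq)
      qed
      finally have "ennreal (norm (h s)) \<le> ennreal (\<bar>mean_reward f \<mu> s i\<bar> + \<delta> s)"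
        by (simp add: ennreal_leI)
      also have "\<dots> = ennreal \<bar>mean_reward f \<mu> s i\<bar> + ennreal (\<delta> s)"
        using \<delta> by (intro ennreal_plus) auto
      also have "\<dots> \<le> F s + ennreal (\<delta> s)" by (intro add_right_mono mean_le)
      finally show ?thesis using True by simp
    qed (simp add: h_def)
  qed
  also have "\<dots> < \<infinity>" unfolding F_def by (rule M_finite)
  finally have "integrable lborel h" using h_meas by (intro integrableI_bounded)
  then have "integrable lborel (\<lambda>s. C * h s)" by simp
  also have "(\<lambda>s. C * h s) = (\<lambda>s. indicator {0..} s *\<^sub>R reward_rate \<mu> s i)"
    using C(1) by (auto simp: h_def reward_rate_def H_def fun_eq_iff)
  finally show ?thesis by (simp add: set_integrable_def)
qed

lemma reward_rate_right_limit:
  assumes \<mu>: "\<mu> \<in> prob_measures U"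
  shows "((\<lambda>s. reward_rate \<mu> s i) \<longlongrightarrow> reward_rate \<mu> 0 i) (at_right 0)"
proof -
  interpret prob_space \<mu> using \<mu> by (simp add: prob_measures_def)
  have sets: "sets \<mu> = sets (restrict_space borel U)" using \<mu> by (simp add: prob_measures_def)
  have sp: "space \<mu> = U" using sets_eq_imp_space_eq[OF sets] by (simp add: space_restrict_space)
  obtain \<epsilon> K where \<epsilon>: "0 < \<epsilon>" and K: "\<And>t i u. 0 \<le> t \<Longrightarrow> t \<le> \<epsilon> \<Longrightarrow> u \<in> U \<Longrightarrow> \<bar>f t i u\<bar> \<le> K"
    using f_bdd_near_0 by (metis atLeastAtMost_iff)
  have f_meas': "f t i \<in> borel_measurable \<mu>" if "0 \<le> t" for t
    using f_meas[OF that] measurable_cong_sets[OF sets refl] by blast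
  have "((\<lambda>s. mean_reward f \<mu> s i) \<longlongrightarrow> mean_reward f \<mu> 0 i) (at_right 0)"
  proof (rule tendsto_at_right_sequentially[OF \<epsilon>])
    fix S :: "nat \<Rightarrow> real" assume S: "\<And>n. 0 < S n" "\<And>n. S n < \<epsilon>" "S \<longlonglongrightarrow> 0"
    show "(\<lambda>n. mean_reward f \<mu> (S n) i) \<longlonglongrightarrow> mean_reward f \<mu> 0 i"
      unfolding mean_reward_def
    proof (rule integral_dominated_convergence[where w = "\<lambda>_. K"])
      show "AE u in \<mu>. (\<lambda>n. f (S n) i u) \<longlonglongrightarrow> f 0 i u"
      proof (rule AE_I2)
        fix u assume "u \<in> space \<mu>"
        then show "(\<lambda>n. f (S n) i u) \<longlonglongrightarrow> f 0 i u"
          using S(1,3) by (intro continuous_on_tendsto_compose[OF f_cont])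
            (auto simp: sp less_imp_le)
      qed
      show "AE u in \<mu>. norm (f (S n) i u) \<le> K" for n
        using K[of "S n"] S(1,2)[of n] by (intro AE_I2) (auto simp: sp)
      show "f (S n) i \<in> borel_measurable \<mu>" for n
        using S(1)[of n] by (intro f_meas') simp
    qed (auto intro: f_meas')
  qed
  then show ?thesis
    unfolding reward_rate_def
    by (intro tendsto_intros right_limit_of_continuous_on[OF \<delta>_cont]) auto
qed

section \<open>Values of stationary and concatenated controls, and their first-order
  expansion\<close>

lemma regular_controlD: "\<pi> \<in> regular_controls U \<Longrightarrow> \<pi> i \<in> prob_measures U"
  by (auto simp: regular_controls_def relaxed_controls_def)

text \<open>The semigroup is read off from the chains supplied by \<open>controlled_chains\<close>
  rather than built as a matrix exponential; any initial state will do.\<close>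

lemma control_semigroup:
  assumes "\<pi> \<in> regular_controls U"
  obtains P where "transition_function P" "has_generator P (\<lambda>_. control_generator q \<pi>)"
proof -
  have "markov_chain (M (\<lambda>_. \<pi>) i) (X (\<lambda>_. \<pi>) i) (\<lambda>_. control_generator q \<pi>) i" for i
    using chains assms by (simp add: controlled_chains_def)
  from markov_chain_marginal[OF this] that show ?thesis by blast
qed

lemma value_stationary:
  assumes \<pi>: "\<pi> \<in> regular_controls U"
    and P: "transition_function P" "has_generator P (\<lambda>_. control_generator q \<pi>)"
  shows "J (\<lambda>_. \<pi>) i = (\<Sum>j\<in>UNIV. LINT s:{0..}|lborel. P 0 s $ i $ j * reward_rate (\<pi> j) s j)"
proof -
  have chain: "markov_chain (M (\<lambda>_. \<pi>) i) (X (\<lambda>_. \<pi>) i) (\<lambda>_. control_generator q \<pi>) i"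
    using chains \<pi> by (simp add: controlled_chains_def)
  obtain R where R: "transition_function R" "has_generator R (\<lambda>_. control_generator q \<pi>)"
    "\<And>t j. 0 \<le> t \<Longrightarrow>
      measure (M (\<lambda>_. \<pi>) i) {\<omega> \<in> space (M (\<lambda>_. \<pi>) i). X (\<lambda>_. \<pi>) i t \<omega> = j} = R 0 t $ i $ j"
    using markov_chain_marginal[OF chain] by blast
  \<comment> \<open>The chain started in \<open>i\<close> comes with its own transition function
    \<open>R\<close>; uniqueness replaces it by the common \<open>P\<close>, so that one semigroup
    serves all initial states.\<close>
  have eq: "R 0 s = P 0 s" if "0 \<le> s" for s
    using transition_function_unique[OF R(1,2) P, of 0 0 s _ s] that by simp
  have "J (\<lambda>_. \<pi>) i = (\<Sum>j\<in>UNIV. LINT s:{0..}|lborel.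
      measure (M (\<lambda>_. \<pi>) i) {\<omega> \<in> space (M (\<lambda>_. \<pi>) i). X (\<lambda>_. \<pi>) i s \<omega> = j} * reward_rate (\<pi> j) s j)"
    unfolding value_at_def reward_rate_def[symmetric]
    by (rule markov_chain_expected_integral[OF chain])
      (intro reward_rate_integrable regular_controlD[OF \<pi>])
  also have "\<dots> = (\<Sum>j\<in>UNIV. LINT s:{0..}|lborel. P 0 s $ i $ j * reward_rate (\<pi> j) s j)"
    by (intro sum.cong refl set_lebesgue_integral_cong) (auto simp: R(3) eq)
  finally show ?thesis .
qed

lemma concat_control_same: "concat_control \<pi> \<epsilon> \<pi> = (\<lambda>_. \<pi>)"
  by (simp add: concat_control_def)

text \<open>Chapman-Kolmogorov at the switching time. After \<epsilon> the dynamics restart, so the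
  transition probabilities depend on \<open>s - \<epsilon>\<close>, but the rewards keep the
  calendar time \<open>s\<close>. Hence the inner sums are not values of \<pi>, and become so only
  in the limit.\<close>

lemma value_concat:
  assumes \<pi>: "\<pi> \<in> regular_controls U" and \<pi>': "\<pi>' \<in> regular_controls U"
    and P: "transition_function P" "has_generator P (\<lambda>_. control_generator q \<pi>)"
    and P': "transition_function P'" "has_generator P' (\<lambda>_. control_generator q \<pi>')"
    and \<epsilon>: "0 < \<epsilon>"
  shows "J (concat_control \<pi>' \<epsilon> \<pi>) i =
    (LINT s:{0..<\<epsilon>}|lborel. \<Sum>j\<in>UNIV. P' 0 s $ i $ j * reward_rate (\<pi>' j) s j) +
    (\<Sum>k\<in>UNIV. P' 0 \<epsilon> $ i $ k *
      (\<Sum>j\<in>UNIV. LINT s:{\<epsilon>..}|lborel. P 0 (s - \<epsilon>) $ k $ j * reward_rate (\<pi> j) s j))"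
proof -
  define \<alpha> where "\<alpha> = concat_control \<pi>' \<epsilon> \<pi>"
  define G where "G s j = reward_rate (\<alpha> s j) s j" for s j
  have \<alpha>: "\<alpha> s = \<pi>'" if "s < \<epsilon>" for s using that by (simp add: \<alpha>_def concat_control_def)
  have \<alpha>2: "\<alpha> s = \<pi>" if "\<epsilon> \<le> s" for s using that by (simp add: \<alpha>_def concat_control_def)
  have chain: "markov_chain (M \<alpha> i) (X \<alpha> i) (\<lambda>s. control_generator q (\<alpha> s)) i"
    unfolding \<alpha>_def using chains \<pi> \<pi>' \<epsilon> by (simp add: controlled_chains_def)
  obtain R where R: "transition_function R" "has_generator R (\<lambda>s. control_generator q (\<alpha> s))"
    "\<And>t j. 0 \<le> t \<Longrightarrow> measure (M \<alpha> i) {\<omega> \<in> space (M \<alpha> i). X \<alpha> i t \<omega> = j} = R 0 t $ i $ j"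
    using markov_chain_marginal[OF chain] by blast
  \<comment> \<open>The endpoint \<open>s\<close> = \<epsilon> matters: the generator has already
    switched there, yet continuity still gives \<open>R 0 \<epsilon> = P' 0 \<epsilon>\<close>, the
    left factor in Chapman-Kolmogorov below.\<close>
  have before: "R 0 s = P' 0 s" if "0 \<le> s" "s \<le> \<epsilon>" for s
    using transition_function_unique[OF R(1,2) P', of 0 0 \<epsilon> "control_generator q \<pi>'" s] that \<alpha> by simp
  have after: "R \<epsilon> s = P 0 (s - \<epsilon>)" if "\<epsilon> \<le> s" for s
    using transition_function_unique[OF R(1,2) P, of \<epsilon> 0 "s - \<epsilon>" "control_generator q \<pi>" "s - \<epsilon>"]
      that \<alpha>2 \<epsilon> by simp
  have G1: "set_integrable lborel {0..<\<epsilon>} (\<lambda>s. G s j)" for j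
  proof -
    have "set_integrable lborel {0..<\<epsilon>} (\<lambda>s. reward_rate (\<pi>' j) s j)"
      by (rule set_integrable_subset[OF reward_rate_integrable[OF regular_controlD[OF \<pi>']]]) auto
    then show ?thesis
      by (rule set_integrable_cong[THEN iffD1, rotated 3]) (auto simp: G_def \<alpha>)
  qed
  have rate2: "set_integrable lborel {\<epsilon>..} (\<lambda>s. reward_rate (\<pi> j) s j)" for j
    by (rule set_integrable_subset[OF reward_rate_integrable[OF regular_controlD[OF \<pi>]]]) (use \<epsilon> in auto)
  have G2: "set_integrable lborel {\<epsilon>..} (\<lambda>s. G s j)" for j
    using rate2 by (rule set_integrable_cong[THEN iffD1, rotated 3]) (auto simp: G_def \<alpha>2)
  have Un: "{0..} = {0..<\<epsilon>} \<union> {\<epsilon>..}" using \<epsilon> by auto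
  have G: "set_integrable lborel {0..} (\<lambda>s. G s j)" for j
    unfolding Un by (intro set_integrable_Un G1 G2) auto
  have RG: "set_integrable lborel {0..} (\<lambda>s. R 0 s $ i $ j * G s j)" for j
    by (intro set_integrable_mult_bounded G transition_entry_continuous[OF R(2)] transition_abs_le_1[OF R(1)]) auto
  have PG: "set_integrable lborel {\<epsilon>..} (\<lambda>s. P 0 (s - \<epsilon>) $ k $ j * reward_rate (\<pi> j) s j)" for j k
    by (intro set_integrable_mult_bounded rate2 transition_abs_le_1[OF P(1)]
        continuous_on_compose2[OF transition_entry_continuous[OF P(2), of 0]])
      (auto intro!: continuous_intros)
  have "J \<alpha> i = (\<Sum>j\<in>UNIV. LINT s:{0..}|lborel. measure (M \<alpha> i) {\<omega> \<in> space (M \<alpha> i). X \<alpha> i s \<omega> = j} * G s j)"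
    unfolding value_at_def reward_rate_def[symmetric] G_def[symmetric]
    by (rule markov_chain_expected_integral[OF chain G])
  also have "\<dots> = (\<Sum>j\<in>UNIV. LINT s:{0..}|lborel. R 0 s $ i $ j * G s j)"
    by (intro sum.cong refl set_lebesgue_integral_cong) (auto simp: R(3))
  also have "\<dots> = (\<Sum>j\<in>UNIV. (LINT s:{0..<\<epsilon>}|lborel. R 0 s $ i $ j * G s j) + (LINT s:{\<epsilon>..}|lborel. R 0 s $ i $ j * G s j))"
    unfolding Un using \<epsilon>
    by (intro sum.cong refl set_integral_Un set_integrable_subset[OF RG]) auto
  also have "\<dots> = (\<Sum>j\<in>UNIV. LINT s:{0..<\<epsilon>}|lborel. R 0 s $ i $ j * G s j)
      + (\<Sum>j\<in>UNIV. LINT s:{\<epsilon>..}|lborel. R 0 s $ i $ j * G s j)"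
    by (rule sum.distrib)
  also have "(\<Sum>j\<in>UNIV. LINT s:{0..<\<epsilon>}|lborel. R 0 s $ i $ j * G s j) =
      (\<Sum>j\<in>UNIV. LINT s:{0..<\<epsilon>}|lborel. P' 0 s $ i $ j * reward_rate (\<pi>' j) s j)"
    by (intro sum.cong refl set_lebesgue_integral_cong) (auto simp: G_def \<alpha> before)
  also have "\<dots> = (LINT s:{0..<\<epsilon>}|lborel. \<Sum>j\<in>UNIV. P' 0 s $ i $ j * reward_rate (\<pi>' j) s j)"
  proof -
    have "set_integrable lborel {0..<\<epsilon>} (\<lambda>s. P' 0 s $ i $ j * reward_rate (\<pi>' j) s j)" for j
    proof (rule set_integrable_subset)
      show "set_integrable lborel {0..} (\<lambda>s. P' 0 s $ i $ j * reward_rate (\<pi>' j) s j)"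
        by (intro set_integrable_mult_bounded transition_entry_continuous[OF P'(2)]
            transition_abs_le_1[OF P'(1)] reward_rate_integrable regular_controlD[OF \<pi>']) auto
    qed auto
    then show ?thesis
      unfolding set_integrable_def set_lebesgue_integral_def scaleR_sum_right
      by (intro Bochner_Integration.integral_sum[symmetric])
  qed
  also have "(\<Sum>j\<in>UNIV. LINT s:{\<epsilon>..}|lborel. R 0 s $ i $ j * G s j) =
      (\<Sum>j\<in>UNIV. \<Sum>k\<in>UNIV. P' 0 \<epsilon> $ i $ k * (LINT s:{\<epsilon>..}|lborel. P 0 (s - \<epsilon>) $ k $ j * reward_rate (\<pi> j) s j))"
  proof (rule sum.cong[OF refl])
    fix j
    have "(LINT s:{\<epsilon>..}|lborel. R 0 s $ i $ j * G s j) =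
      (LINT s:{\<epsilon>..}|lborel. \<Sum>k\<in>UNIV. P' 0 \<epsilon> $ i $ k * (P 0 (s - \<epsilon>) $ k $ j * reward_rate (\<pi> j) s j))"
    proof (rule set_lebesgue_integral_cong)
      show "\<forall>s. s \<in> {\<epsilon>..} \<longrightarrow> R 0 s $ i $ j * G s j =
          (\<Sum>k\<in>UNIV. P' 0 \<epsilon> $ i $ k * (P 0 (s - \<epsilon>) $ k $ j * reward_rate (\<pi> j) s j))"
      proof (intro allI impI)
        fix s assume s: "s \<in> {\<epsilon>..}"
        have "R 0 s = P' 0 \<epsilon> ** P 0 (s - \<epsilon>)"
          using transition_comp[OF R(1), of 0 \<epsilon> s] s \<epsilon> before[of \<epsilon>] after[of s] by simp
        then show "R 0 s $ i $ j * G s j =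
            (\<Sum>k\<in>UNIV. P' 0 \<epsilon> $ i $ k * (P 0 (s - \<epsilon>) $ k $ j * reward_rate (\<pi> j) s j))"
          using s by (simp add: matrix_matrix_mult_def G_def \<alpha>2 sum_distrib_right mult.assoc)
      qed
    qed simp
    also have "\<dots> = (\<Sum>k\<in>UNIV. LINT s:{\<epsilon>..}|lborel. P' 0 \<epsilon> $ i $ k * (P 0 (s - \<epsilon>) $ k $ j * reward_rate (\<pi> j) s j))"
    proof -
      have "set_integrable lborel {\<epsilon>..} (\<lambda>s. P' 0 \<epsilon> $ i $ k * (P 0 (s - \<epsilon>) $ k $ j * reward_rate (\<pi> j) s j))" for k
        by (intro set_integrable_mult_right PG)
      then show ?thesis
        unfolding set_integrable_def set_lebesgue_integral_def scaleR_sum_right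
        by (intro Bochner_Integration.integral_sum)
    qed
    finally show "(LINT s:{\<epsilon>..}|lborel. R 0 s $ i $ j * G s j) =
        (\<Sum>k\<in>UNIV. P' 0 \<epsilon> $ i $ k * (LINT s:{\<epsilon>..}|lborel. P 0 (s - \<epsilon>) $ k $ j * reward_rate (\<pi> j) s j))"
      by simp
  qed
  also have "\<dots> = (\<Sum>k\<in>UNIV. P' 0 \<epsilon> $ i $ k *
      (\<Sum>j\<in>UNIV. LINT s:{\<epsilon>..}|lborel. P 0 (s - \<epsilon>) $ k $ j * reward_rate (\<pi> j) s j))"
    unfolding sum_distrib_left by (rule sum.swap)
  finally show ?thesis unfolding \<alpha>_def .
qed

lemma value_derivative:
  assumes \<pi>: "\<pi> \<in> regular_controls U" and \<pi>': "\<pi>' \<in> regular_controls U"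
  shows "((\<lambda>\<epsilon>. (J (concat_control \<pi>' \<epsilon> \<pi>) i - J (\<lambda>_. \<pi>) i) / \<epsilon>) \<longlongrightarrow>
    reward_rate (\<pi>' i) 0 i + (control_generator q \<pi>' $ i) \<bullet> value_vec U f \<delta> lam M X \<pi>
    - (reward_rate (\<pi> i) 0 i + (control_generator q \<pi> $ i) \<bullet> value_vec U f \<delta> lam M X \<pi>)) (at_right 0)"
proof -
  obtain P where P: "transition_function P" "has_generator P (\<lambda>_. control_generator q \<pi>)"
    using control_semigroup[OF \<pi>] .
  obtain P' where P': "transition_function P'" "has_generator P' (\<lambda>_. control_generator q \<pi>')"
    using control_semigroup[OF \<pi>'] .
  define V where "V \<epsilon> k = (\<Sum>j\<in>UNIV. LINT s:{\<epsilon>..}|lborel. P 0 (s - \<epsilon>) $ k $ j * reward_rate (\<pi> j) s j)" for \<epsilon> k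
  define g where "g R \<kappa> s = (\<Sum>j\<in>UNIV. R 0 s $ i $ j * reward_rate (\<kappa> j) s j)"
    for R :: "real \<Rightarrow> real \<Rightarrow> real ^ 's ^ 's" and \<kappa> s
  have V: "((\<lambda>\<epsilon>. V \<epsilon> k) \<longlongrightarrow> J (\<lambda>_. \<pi>) k) (at_right 0)" for k
    unfolding V_def value_stationary[OF \<pi> P]
    by (intro tendsto_sum shifted_integral_tendsto transition_entry_continuous[OF P(2)]
        transition_abs_le_1[OF P(1)] reward_rate_integrable regular_controlD[OF \<pi>]) auto
  have avg: "((\<lambda>\<epsilon>. (LINT s:{0..<\<epsilon>}|lborel. g R \<kappa> s) / \<epsilon>) \<longlongrightarrow> reward_rate (\<kappa> i) 0 i) (at_right 0)"
    if \<kappa>: "\<kappa> \<in> regular_controls U"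
      and R: "transition_function R" "has_generator R (\<lambda>_. control_generator q \<kappa>)" for R \<kappa>
  proof -
    have g0: "g R \<kappa> 0 = reward_rate (\<kappa> i) 0 i"
      by (simp add: g_def transition_refl[OF R(1)] mat_def if_distrib if_distribR cong: if_cong)
    have "((\<lambda>s. g R \<kappa> s) \<longlongrightarrow> g R \<kappa> 0) (at_right 0)"
      unfolding g_def
      by (intro tendsto_sum tendsto_mult reward_rate_right_limit regular_controlD[OF \<kappa>]
          right_limit_of_continuous_on transition_entry_continuous[OF R(2)]) auto
    moreover have "set_integrable lborel {0..} (\<lambda>s. g R \<kappa> s)"
    proof -
      have "set_integrable lborel {0..} (\<lambda>s. R 0 s $ i $ j * reward_rate (\<kappa> j) s j)" for j
        by (intro set_integrable_mult_bounded transition_entry_continuous[OF R(2)]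
            transition_abs_le_1[OF R(1)] reward_rate_integrable regular_controlD[OF \<kappa>]) auto
      then show ?thesis
        unfolding set_integrable_def g_def scaleR_sum_right
        by (intro Bochner_Integration.integrable_sum)
    qed
    ultimately show ?thesis
      unfolding g0[symmetric] by (intro average_at_right_tendsto)
  qed
  \<comment> \<open>The matrix \<open>mat 1\<close> is subtracted from both laws at time \<epsilon>,
    so that each becomes a difference quotient converging to a generator; the two copies cancel in
    the difference. The factors \<open>V \<epsilon> k\<close> then enter through their limits
    only.\<close>
  have "((\<lambda>\<epsilon>. (LINT s:{0..<\<epsilon>}|lborel. g P' \<pi>' s) / \<epsilon> - (LINT s:{0..<\<epsilon>}|lborel. g P \<pi> s) / \<epsilon>
      + (\<Sum>k\<in>UNIV. ((P' 0 \<epsilon> $ i $ k - mat 1 $ i $ k) / \<epsilon> - (P 0 \<epsilon> $ i $ k - mat 1 $ i $ k) / \<epsilon>) * V \<epsilon> k)) \<longlongrightarrow>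
    reward_rate (\<pi>' i) 0 i - reward_rate (\<pi> i) 0 i
      + (\<Sum>k\<in>UNIV. (control_generator q \<pi>' $ i $ k - control_generator q \<pi> $ i $ k) * J (\<lambda>_. \<pi>) k)) (at_right 0)"
    by (intro tendsto_add tendsto_diff tendsto_sum tendsto_mult V avg[OF \<pi>' P'] avg[OF \<pi> P]
        transition_entry_derivative[OF P(2)] transition_entry_derivative[OF P'(2)])
  moreover have "\<forall>\<^sub>F \<epsilon> in at_right 0. (LINT s:{0..<\<epsilon>}|lborel. g P' \<pi>' s) / \<epsilon> - (LINT s:{0..<\<epsilon>}|lborel. g P \<pi> s) / \<epsilon>
      + (\<Sum>k\<in>UNIV. ((P' 0 \<epsilon> $ i $ k - mat 1 $ i $ k) / \<epsilon> - (P 0 \<epsilon> $ i $ k - mat 1 $ i $ k) / \<epsilon>) * V \<epsilon> k) =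
      (J (concat_control \<pi>' \<epsilon> \<pi>) i - J (\<lambda>_. \<pi>) i) / \<epsilon>"
    using eventually_at_right_less[of 0]
  proof eventually_elim
    case (elim \<epsilon>)
    have "J (concat_control \<pi>' \<epsilon> \<pi>) i = (LINT s:{0..<\<epsilon>}|lborel. g P' \<pi>' s) + (\<Sum>k\<in>UNIV. P' 0 \<epsilon> $ i $ k * V \<epsilon> k)"
      unfolding V_def g_def by (rule value_concat[OF \<pi> \<pi>' P P' elim])
    \<comment> \<open>The unperturbed control is treated as its own concatenation. This splits its
      value at \<epsilon> with the same continuation values \<open>V \<epsilon> k\<close>, so the
      terms of order one cancel.\<close>
    moreover have "J (\<lambda>_. \<pi>) i = (LINT s:{0..<\<epsilon>}|lborel. g P \<pi> s) + (\<Sum>k\<in>UNIV. P 0 \<epsilon> $ i $ k * V \<epsilon> k)"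
      unfolding V_def g_def using value_concat[OF \<pi> \<pi> P P elim, of i] by (simp only: concat_control_same)
    moreover have "(\<Sum>k\<in>UNIV. ((P' 0 \<epsilon> $ i $ k - mat 1 $ i $ k) / \<epsilon> - (P 0 \<epsilon> $ i $ k - mat 1 $ i $ k) / \<epsilon>) * V \<epsilon> k) =
        ((\<Sum>k\<in>UNIV. P' 0 \<epsilon> $ i $ k * V \<epsilon> k) - (\<Sum>k\<in>UNIV. P 0 \<epsilon> $ i $ k * V \<epsilon> k)) / \<epsilon>"
      unfolding sum_subtractf[symmetric] sum_divide_distrib
      by (intro sum.cong refl) (simp add: left_diff_distrib flip: diff_divide_distrib)
    ultimately show ?case by (simp add: add_divide_distrib diff_divide_distrib)
  qed
  ultimately have "((\<lambda>\<epsilon>. (J (concat_control \<pi>' \<epsilon> \<pi>) i - J (\<lambda>_. \<pi>) i) / \<epsilon>) \<longlongrightarrow>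
    reward_rate (\<pi>' i) 0 i - reward_rate (\<pi> i) 0 i
      + (\<Sum>k\<in>UNIV. (control_generator q \<pi>' $ i $ k - control_generator q \<pi> $ i $ k) * J (\<lambda>_. \<pi>) k)) (at_right 0)"
    by (rule Lim_transform_eventually)
  then show ?thesis
    by (simp add: inner_vec_def value_vec_def left_diff_distrib sum_subtractf algebra_simps)
qed

section \<open>The Gibbs control as unique maximizer of the first-order gain\<close>

definition pseudo_reward :: "real ^ 's \<Rightarrow> 's \<Rightarrow> real ^ 'l \<Rightarrow> real" where
  "pseudo_reward y i u = f 0 i u + (q u $ i) \<bullet> y"

lemma Gamma_map_eq_gibbs_density:
  "Gamma_map U q f lam y i = gibbs_density U lam (pseudo_reward y i)"
  by (simp add: fun_eq_iff Gamma_map_def gibbs_density_def pseudo_reward_def)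

lemma pseudo_reward_measurable: "pseudo_reward y i \<in> borel_measurable (restrict_space borel U)"
  and pseudo_reward_bounded: "\<exists>C. \<forall>u\<in>U. \<bar>pseudo_reward y i u\<bar> \<le> C"
proof -
  have U: "U \<noteq> {}" using U_pos by auto
  have q: "(\<lambda>u. q u $ i $ k) \<in> borel_measurable (restrict_space borel U)"
    "\<exists>C. \<forall>u\<in>U. \<bar>q u $ i $ k\<bar> \<le> C" for k
    using integrable_all_prob_measures[OF U, of "\<lambda>u. q u $ i $ k"] q_int by auto
  have [measurable]: "f 0 i \<in> borel_measurable (restrict_space borel U)"
    by (rule f_meas) simp
  have [measurable]: "(\<lambda>u. q u $ i $ k) \<in> borel_measurable (restrict_space borel U)" for k
    by (rule q(1))
  show "pseudo_reward y i \<in> borel_measurable (restrict_space borel U)"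
    unfolding pseudo_reward_def[abs_def] inner_vec_def inner_real_def by measurable
  obtain K where K: "\<And>u. u \<in> U \<Longrightarrow> \<bar>f 0 i u\<bar> \<le> K"
    using f_bdd_near_0 by force
  obtain C where C: "\<And>k u. u \<in> U \<Longrightarrow> \<bar>q u $ i $ k\<bar> \<le> C k"
    using q(2) by metis
  have "\<bar>pseudo_reward y i u\<bar> \<le> K + (\<Sum>k\<in>UNIV. C k * \<bar>y $ k\<bar>)" if u: "u \<in> U" for u
  proof -
    have "\<bar>(q u $ i) \<bullet> y\<bar> \<le> (\<Sum>k\<in>UNIV. \<bar>q u $ i $ k * y $ k\<bar>)"
      unfolding inner_vec_def inner_real_def by (rule sum_abs)
    also have "\<dots> \<le> (\<Sum>k\<in>UNIV. C k * \<bar>y $ k\<bar>)"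
      using C[OF u] by (intro sum_mono) (simp add: abs_mult mult_right_mono)
    finally show ?thesis
      using K[OF u] unfolding pseudo_reward_def by linarith
  qed
  then show "\<exists>C. \<forall>u\<in>U. \<bar>pseudo_reward y i u\<bar> \<le> C" by blast
qed

definition gain :: "real ^ 's \<Rightarrow> ('s, 'l) control \<Rightarrow> 's \<Rightarrow> real" where
  "gain y \<pi> i = reward_rate (\<pi> i) 0 i + (control_generator q \<pi> $ i) \<bullet> y"

lemma regular_control_density:
  assumes "\<pi> \<in> regular_controls U"
  obtains \<rho> where "\<rho> \<in> prob_densities U" "\<pi> i = measure_of_density U \<rho>"
    "integrable (leb_on U) (\<lambda>u. ln (\<rho> u) * \<rho> u)"
proof -
  obtain \<rho> where \<rho>: "\<rho> \<in> prob_densities U" "\<pi> i = measure_of_density U \<rho>"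
    and "- \<infinity> < entropy_measure U (\<pi> i)"
    using assms unfolding regular_controls_def by blast
  then have "integrable (leb_on U) (\<lambda>u. ln (\<rho> u) * \<rho> u)"
    by (simp only: entropy_measure_of_density[OF U_compact \<rho>(1)] entropy_density_finite_iff(1)[OF U_compact \<rho>(1)])
  with \<rho> that show ?thesis by blast
qed

text \<open>Passes from the form of \<open>gain\<close> produced by \<open>value_derivative\<close>
  to the functional of the Gibbs principle. The generator row is linear in the measure, so reward
  and rates merge into one integral of \<open>pseudo_reward\<close>, the Hamiltonian at time 0 with
  continuation values \<open>y\<close>. Because \<open>\<delta> 0 = 1\<close>, the weight of the
  entropy is exactly the temperature \<open>lam\<close> in \<open>Gamma_map\<close>.\<close>

lemma gain_eq:
  assumes \<rho>: "\<rho> \<in> prob_densities U" "\<pi> i = measure_of_density U \<rho>"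
    and ent: "integrable (leb_on U) (\<lambda>u. ln (\<rho> u) * \<rho> u)"
  shows "gain y \<pi> i =
    (\<integral>u. pseudo_reward y i u * \<rho> u \<partial>leb_on U) - lam * (\<integral>u. ln (\<rho> u) * \<rho> u \<partial>leb_on U)"
proof -
  have \<mu>: "\<pi> i \<in> prob_measures U" using \<rho> measure_of_density_prob by simp
  interpret prob_space "\<pi> i" using \<mu> by (simp add: prob_measures_def)
  have sets: "sets (\<pi> i) = sets (restrict_space borel U)" using \<mu> by (simp add: prob_measures_def)
  have sp: "space (\<pi> i) = U" using sets_eq_imp_space_eq[OF sets] by (simp add: space_restrict_space)
  have q_inner: "integrable (\<pi> i) (\<lambda>u. (q u $ i) \<bullet> y)"
    "(\<integral>u. (q u $ i) \<bullet> y \<partial>\<pi> i) = (control_generator q \<pi> $ i) \<bullet> y"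
    unfolding inner_vec_def control_generator_def mean_rates_def using q_int[OF \<mu>]
    by (auto simp: Bochner_Integration.integral_sum)
  have f_int: "integrable (\<pi> i) (f 0 i)"
  proof -
    obtain K where K: "\<And>u. u \<in> U \<Longrightarrow> \<bar>f 0 i u\<bar> \<le> K"
      using f_bdd_near_0 by force
    have "f 0 i \<in> borel_measurable (\<pi> i)"
      using f_meas[of 0 i] measurable_cong_sets[OF sets refl] by auto
    then show ?thesis
      using K by (intro integrable_const_bound[where B = K] AE_I2) (auto simp: sp)
  qed
  have "mean_reward f (\<pi> i) 0 i + (control_generator q \<pi> $ i) \<bullet> y = (\<integral>u. pseudo_reward y i u \<partial>\<pi> i)"
    unfolding mean_reward_def pseudo_reward_def q_inner(2)[symmetric]
    by (rule Bochner_Integration.integral_add[OF f_int q_inner(1), symmetric])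
  also have "\<dots> = (\<integral>u. pseudo_reward y i u * \<rho> u \<partial>leb_on U)"
    unfolding \<rho>(2) by (rule integral_measure_of_density[OF \<rho>(1) pseudo_reward_measurable])
  finally show ?thesis
    using entropy_density_finite_iff(2)[OF U_compact \<rho>(1) ent]
    by (simp add: gain_def reward_rate_def \<delta>_0 \<rho>(2) entropy_measure_of_density[OF U_compact \<rho>(1)])
qed

text \<open>By \<open>value_derivative\<close> the difference quotient has a genuine limit, so the
  condition on the limsup is the sign of a difference of gains. Since the gain in state
  \<open>i\<close> involves a control through its action distribution at \<open>i\<close> alone, the
  equilibrium condition decouples into one static maximization per state.\<close>

lemma regular_equilibrium_iff:
  "regular_equilibrium U f \<delta> lam M X \<pi> \<longleftrightarrow> \<pi> \<in> regular_controls U \<and>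
    (\<forall>\<pi>'\<in>regular_controls U. \<forall>i.
      gain (value_vec U f \<delta> lam M X \<pi>) \<pi>' i \<le> gain (value_vec U f \<delta> lam M X \<pi>) \<pi> i)"
proof -
  have "Limsup (at_right 0) (\<lambda>\<epsilon>. ereal ((J (concat_control \<pi>' \<epsilon> \<pi>) i - J (\<lambda>_. \<pi>) i) / \<epsilon>)) =
      ereal (gain (value_vec U f \<delta> lam M X \<pi>) \<pi>' i - gain (value_vec U f \<delta> lam M X \<pi>) \<pi> i)"
    if "\<pi> \<in> regular_controls U" "\<pi>' \<in> regular_controls U" for \<pi>' i
    unfolding gain_def
    by (intro lim_imp_Limsup tendsto_ereal value_derivative that) (simp add: trivial_limit_at_right_real)
  then show ?thesis
    unfolding regular_equilibrium_def by auto
qed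

text \<open>The Gibbs principle at each state, with \<open>pseudo_reward y i\<close> as the
  exponent. Its uniqueness part determines densities almost everywhere; at the level of measures
  this is an honest equality, which is why \<open>gain_eq_Gamma\<close> identifies the action
  distributions themselves.\<close>

lemma Gamma_map_props:
  shows Gamma_map_prob: "Gamma_map U q f lam y i \<in> prob_densities U"
    and Gamma_map_entropy:
      "integrable (leb_on U) (\<lambda>u. ln (Gamma_map U q f lam y i u) * Gamma_map U q f lam y i u)"
    and gain_le_Gamma: "\<pi> \<in> regular_controls U \<Longrightarrow> gain y \<pi> i \<le> gain y (Gamma_control U q f lam y) i"
    and gain_eq_Gamma: "\<pi> \<in> regular_controls U \<Longrightarrow> gain y \<pi> i = gain y (Gamma_control U q f lam y) i \<Longrightarrow>
      \<pi> i = Gamma_control U q f lam y i"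
proof -
  let ?\<gamma> = "Gamma_map U q f lam y i"
  obtain C where "\<forall>u\<in>U. \<bar>pseudo_reward y i u\<bar> \<le> C"
    using pseudo_reward_bounded by blast
  note gibbs = gibbs_variational_principle[OF U_compact U_pos lam_pos pseudo_reward_measurable this]
  show \<gamma>: "?\<gamma> \<in> prob_densities U"
    unfolding Gamma_map_eq_gibbs_density by (rule gibbs(1))
  show \<gamma>_ent: "integrable (leb_on U) (\<lambda>u. ln (?\<gamma> u) * ?\<gamma> u)"
    unfolding Gamma_map_eq_gibbs_density by (rule gibbs(2))
  have G: "gain y (Gamma_control U q f lam y) i =
      lam * ln (\<integral>u. exp (1 / lam * pseudo_reward y i u) \<partial>leb_on U)"
    using gain_eq[of ?\<gamma> "Gamma_control U q f lam y" i y, OF \<gamma> _ \<gamma>_ent] gibbs(3)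
    by (simp add: Gamma_control_def Gamma_map_eq_gibbs_density)
  assume "\<pi> \<in> regular_controls U"
  then obtain \<rho> where \<rho>: "\<rho> \<in> prob_densities U" "\<pi> i = measure_of_density U \<rho>"
    and ent: "integrable (leb_on U) (\<lambda>u. ln (\<rho> u) * \<rho> u)"
    by (rule regular_control_density)
  show "gain y \<pi> i \<le> gain y (Gamma_control U q f lam y) i"
    unfolding G gain_eq[of \<rho> \<pi> i y, OF \<rho> ent] by (rule gibbs(4)[OF \<rho>(1) ent])
  assume "gain y \<pi> i = gain y (Gamma_control U q f lam y) i"
  then have "AE u in leb_on U. \<rho> u = ?\<gamma> u"
    unfolding G gain_eq[of \<rho> \<pi> i y, OF \<rho> ent] Gamma_map_eq_gibbs_density
    by (rule gibbs(5)[OF \<rho>(1) ent])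
  then have "AE u in leb_on U. ennreal (\<rho> u) = ennreal (?\<gamma> u)"
    by eventually_elim simp
  then show "\<pi> i = Gamma_control U q f lam y i"
    unfolding \<rho>(2) Gamma_control_def measure_of_density_def
    using prob_densitiesD(1)[OF \<rho>(1)] prob_densitiesD(1)[OF \<gamma>]
    by (intro density_cong) auto
qed

lemma Gamma_control_regular: "Gamma_control U q f lam y \<in> regular_controls U"
proof -
  have "- \<infinity> < entropy_measure U (Gamma_control U q f lam y i)" for i
    unfolding Gamma_control_def entropy_measure_of_density[OF U_compact Gamma_map_prob]
    using entropy_density_finite_iff(1)[OF U_compact Gamma_map_prob] Gamma_map_entropy by blast
  then show ?thesis
    unfolding regular_controls_def relaxed_controls_def Gamma_control_def
    using measure_of_density_prob Gamma_map_prob by blast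
qed

text \<open>The Gibbs control is itself regular, hence an admissible deviation. The equilibrium
  property and the maximality of the Gibbs control give the two inequalities between the gains, and
  uniqueness of the maximizer does the rest.\<close>

lemma equilibrium_eq_Gamma_control:
  assumes "regular_equilibrium U f \<delta> lam M X \<pi>" and "y = value_vec U f \<delta> lam M X \<pi>"
  shows "\<pi> = Gamma_control U q f lam y"
proof
  fix i
  have \<pi>: "\<pi> \<in> regular_controls U" using assms by (simp add: regular_equilibrium_iff)
  have "gain y (Gamma_control U q f lam y) i \<le> gain y \<pi> i"
    using assms Gamma_control_regular by (simp add: regular_equilibrium_iff)
  then show "\<pi> i = Gamma_control U q f lam y i"
    using gain_le_Gamma[OF \<pi>] by (intro gain_eq_Gamma[OF \<pi>] antisym)
qed

text \<open>The fixed point equation says that \<open>y\<close> is the value vector of the Gibbs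
  control built from \<open>y\<close>. The gains in the equilibrium criterion are therefore taken at
  the very vector for which this control is the maximizer.\<close>

lemma fixed_point_equilibrium:
  assumes "Psi_map U q f \<delta> lam M X y = y"
  shows "regular_equilibrium U f \<delta> lam M X (Gamma_control U q f lam y)"
  unfolding regular_equilibrium_iff
  using assms Gamma_control_regular gain_le_Gamma by (simp add: Psi_map_def)

end

theorem corollary3p1:
  fixes U :: "(real ^ 'l) set"
    and q :: "real ^ 'l \<Rightarrow> real ^ 's ^ 's::finite"
    and f :: "real \<Rightarrow> 's \<Rightarrow> real ^ 'l \<Rightarrow> real"
    and \<delta> :: "real \<Rightarrow> real"
    and lam :: real
    and M :: "(real \<Rightarrow> ('s, 'l) control) \<Rightarrow> 's \<Rightarrow> 'w measure"
    and X :: "(real \<Rightarrow> ('s, 'l) control) \<Rightarrow> 's \<Rightarrow> real \<Rightarrow> 'w \<Rightarrow> 's"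
  assumes U_compact: "compact U"
    and U_pos: "0 < emeasure lborel U"
    and q_rate: "\<And>u. u \<in> U \<Longrightarrow> rate_matrix (q u)"
    and q_int: "\<And>\<mu> i j. \<mu> \<in> prob_measures U \<Longrightarrow> integrable \<mu> (\<lambda>u. q u $ i $ j)"
    and f_meas: "\<And>t i. 0 \<le> t \<Longrightarrow> f t i \<in> borel_measurable (restrict_space borel U)"
    and f_bdd_near_0:
      "\<exists>\<epsilon>>0. \<exists>K. \<forall>t\<in>{0..\<epsilon>}. \<forall>i. \<forall>u\<in>U. \<bar>f t i u\<bar> \<le> K"
    and \<delta>_range: "\<And>t. 0 \<le> t \<Longrightarrow> \<delta> t \<in> {0..1}"
    and \<delta>_antimono: "antimono_on {0..} \<delta>"
    and \<delta>_0: "\<delta> 0 = 1"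
    and chains: "controlled_chains U q M X"
    and M_finite:
      "(\<integral>\<^sup>+ s\<in>{0..}. ((SUP i\<in>UNIV. SUP u\<in>U. ennreal \<bar>f s i u\<bar>) + ennreal (\<delta> s)) \<partial>lborel) < \<infinity>"
    and f_cont: "\<And>i u. u \<in> U \<Longrightarrow> continuous_on {0..} (\<lambda>t. f t i u)"
    and \<delta>_cont: "continuous_on {0..} \<delta>"
    and lam_pos: "0 < lam"
  shows "\<forall>y :: real ^ 's.
     ((\<exists>\<pi>. regular_equilibrium U f \<delta> lam M X \<pi> \<and> y = value_vec U f \<delta> lam M X \<pi>)
        \<longleftrightarrow> Psi_map U q f \<delta> lam M X y = y) \<and>
     (Psi_map U q f \<delta> lam M X y = y \<longrightarrow>
        Gamma_control U q f lam y \<in> regular_controls U \<and>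
        regular_equilibrium U f \<delta> lam M X (Gamma_control U q f lam y))"
proof -
  interpret control_problem U q f \<delta> lam M X
    by unfold_locales fact+
  show ?thesis
    \<comment> \<open>An equilibrium with value \<open>y\<close> coincides with the Gibbs control of
      \<open>y\<close>, so its value vector is the image of \<open>y\<close> under
      \<open>Psi_map\<close>; conversely the Gibbs control is the witness for \<pi>.\<close>
    using equilibrium_eq_Gamma_control fixed_point_equilibrium Gamma_control_regular
    unfolding Psi_map_def by metis
qed

end
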